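(* Let $X,Y$ be complete metric spaces and let $E,F$ be nontrivial Banach spaces. Suppose that $T:U(X,E)\to U(Y,F)$ is a biseparating map. Then there are a uniform homeomorphism $\varphi:X\to Y$ and a function $\Phi:Y\times E\to F$ such that (1) for each $y\in Y$, $\Phi(y,\cdot):E\to F$ is a bijection with inverse $\Psi(x,\cdot):F\to E$, where $\varphi(x)=y$; (2) $Tf(y)=\Phi(y,f(\varphi^{-1}(y)))$ and $T^{-1}g(x)=\Psi(x,g(\varphi(x)))$ for all $f\in U(X,E)$, $g\in U(Y,F)$ and $x\in X$, $y\in Y$; (3) $\Phi$ is continuous on $Y'\times E$ (i.e. at every point of $Y'\times E$) and $\Psi$ is continuous on $X'\times F$ (i.e. at every point of $X'\times F$); (4) $(x,e)\mapsto\Phi(\varphi(x),e)$ and $(y,e')\mapsto\Psi(\varphi^{-1}(y),e')$ are both $u$-continuous. Conversely, assume that a uniform homeomorphism $\varphi:X\to Y$ and a function $\Phi:Y\times E\to F$ satisfy conditions (1), (3) and (4). Define $Tf(y)=\Phi(y,f(\varphi^{-1}(y)))$ for any $f\in U(X,E)$ and $y\in Y$. Then $T$ is a biseparating map from $U(X,E)$ onto $U(Y,F)$.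
   Context: $U(X,E)$ is the space of uniformly continuous functions $X\to E$; $X',Y'$ are the sets of accumulation points of $X,Y$. A uniform homeomorphism is a bijection that is uniformly continuous with uniformly continuous inverse. For a function $f$ let $C(f)=\{x: f(x)\neq 0\}$, and write $f\perp_h g$ if $C(f-h)\cap C(g-h)=\emptyset$. A map $T$ (not assumed linear) between two function spaces is biseparating if it is a bijection and for all $f,g,h$ in its domain: $f\perp_h g\iff Tf\perp_{Th}Tg$. Let $Z$ be a metric space and $G,H$ Banach spaces. A sequence $(z_n)$ in $Z$ is separated if $\inf_{n\neq m}d(z_n,z_m)>0$. For $\varepsilon>0$, $d_\varepsilon(a,b)=\inf\{\sum_{i=1}^n d(z_{i-1},z_i): n\in\mathbb{N}, z_0=a, z_n=b, d(z_{i-1},z_i)\le\varepsilon\text{ for all }i\}$, with $\inf\emptyset=\infty$. A sequence $((z_n,e_n))$ in $Z\times G$ is a $u$-sequence if $(z_n)$ is separated and there are $\varepsilon>0$, $C<\infty$ with $\|e_n-e_m\|\le C\,d_\varepsilon(z_n,z_m)$ for all $m,n$. A function $\Xi:Z\times G\to H$ is $u$-continuous if for every $u$-sequence $((z_n,e_n))$ and every sequence $((z_n',e_n'))$ in $Z\times G$ with $z_n\neq z_n'$ for all $n$ and $\lim(d(z_n,z_n')+\|e_n-e_n'\|)=0$, one has $\lim\|\Xi(z_n,e_n)-\Xi(z_n',e_n')\|=0$. *)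

theory Defs
  imports "HOL-Analysis.Analysis"
begin

definition unif_cont_maps :: "('a::metric_space \<Rightarrow> 'b::real_normed_vector) set" where
  "unif_cont_maps = {f. uniformly_continuous_on UNIV f}"

definition accumulation_points :: "'a::topological_space set" where
  "accumulation_points = {x. x islimpt UNIV}"

definition uniform_homeomorphism :: "('a::metric_space \<Rightarrow> 'b::metric_space) \<Rightarrow> bool" where
  "uniform_homeomorphism \<phi> \<longleftrightarrow>
     bij \<phi> \<and> uniformly_continuous_on UNIV \<phi> \<and> uniformly_continuous_on UNIV (inv \<phi>)"

definition cozero :: "('a \<Rightarrow> 'b::zero) \<Rightarrow> 'a set" where
  "cozero f = {x. f x \<noteq> 0}"

text \<open>\<open>perp_rel h f g\<close> is the relation \<open>f \<bottom>\<^sub>h g\<close>.\<close>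

definition perp_rel :: "('a \<Rightarrow> 'b::group_add) \<Rightarrow> ('a \<Rightarrow> 'b) \<Rightarrow> ('a \<Rightarrow> 'b) \<Rightarrow> bool" where
  "perp_rel h f g \<longleftrightarrow> cozero (\<lambda>x. f x - h x) \<inter> cozero (\<lambda>x. g x - h x) = {}"

text \<open>The map \<open>T\<close> is only meaningful on the function space \<open>A\<close>; its values elsewhere are
  irrelevant, and its inverse is \<open>inv_into A T\<close>.\<close>

definition biseparating ::
  "('a \<Rightarrow> 'e::group_add) set \<Rightarrow> ('b \<Rightarrow> 'f::group_add) set \<Rightarrow> (('a \<Rightarrow> 'e) \<Rightarrow> ('b \<Rightarrow> 'f)) \<Rightarrow> bool" where
  "biseparating A B T \<longleftrightarrow>
     bij_betw T A B \<and>
     (\<forall>f\<in>A. \<forall>g\<in>A. \<forall>h\<in>A. perp_rel h f g \<longleftrightarrow> perp_rel (T h) (T f) (T g))"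

definition separated_seq :: "(nat \<Rightarrow> 'a::metric_space) \<Rightarrow> bool" where
  "separated_seq z \<longleftrightarrow> 0 < (INF (n, m)\<in>{(n, m). n \<noteq> m}. dist (z n) (z m))"

text \<open>In \<open>ereal\<close> the infimum of the empty set is \<open>\<infinity>\<close>, the value when no \<open>\<epsilon>\<close>-chain joins
  \<open>a\<close> and \<open>b\<close>. Chains of length \<open>0\<close> only occur for \<open>a = b\<close>, where the constant chain of
  length \<open>1\<close> already gives the value \<open>0\<close>.\<close>

definition chain_dist :: "real \<Rightarrow> 'a::metric_space \<Rightarrow> 'a \<Rightarrow> ereal" where
  "chain_dist \<epsilon> a b =
     Inf {ereal (\<Sum>i=1..n. dist (z (i - 1)) (z i)) | (n::nat) (z :: nat \<Rightarrow> 'a).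
            z 0 = a \<and> z n = b \<and> (\<forall>i\<in>{1..n}. dist (z (i - 1)) (z i) \<le> \<epsilon>)}"

text \<open>The convention \<open>0 * \<infinity> = 0\<close> of \<open>ereal\<close> does not matter for the case \<open>C = 0\<close>: under either
  convention, the bound for \<open>C = 0\<close> implies the one for \<open>C = 1\<close>.\<close>

definition u_sequence :: "(nat \<Rightarrow> 'a::metric_space) \<Rightarrow> (nat \<Rightarrow> 'g::real_normed_vector) \<Rightarrow> bool" where
  "u_sequence z e \<longleftrightarrow>
     separated_seq z \<and>
     (\<exists>\<epsilon>>0. \<exists>C\<ge>0. \<forall>m n. ereal (norm (e n - e m)) \<le> ereal C * chain_dist \<epsilon> (z n) (z m))"

definition u_continuous ::
  "('a::metric_space \<times> 'g::real_normed_vector \<Rightarrow> 'h::real_normed_vector) \<Rightarrow> bool" where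
  "u_continuous \<Xi> \<longleftrightarrow>
     (\<forall>z e z' e'. u_sequence z e \<longrightarrow>
        (\<forall>n. z n \<noteq> z' n) \<longrightarrow>
        (\<lambda>n. dist (z n) (z' n) + norm (e n - e' n)) \<longlonglongrightarrow> 0 \<longrightarrow>
        (\<lambda>n. norm (\<Xi> (z n, e n) - \<Xi> (z' n, e' n))) \<longlonglongrightarrow> 0)"

definition fibrewise_inverse ::
  "('x \<Rightarrow> 'y) \<Rightarrow> ('y \<times> 'e \<Rightarrow> 'f) \<Rightarrow> ('x \<times> 'f \<Rightarrow> 'e) \<Rightarrow> bool" where
  "fibrewise_inverse \<phi> \<Phi> \<Psi> \<longleftrightarrow>
     (\<forall>x y. \<phi> x = y \<longrightarrow>
        bij (\<lambda>e. \<Phi> (y, e)) \<and> inv (\<lambda>e. \<Phi> (y, e)) = (\<lambda>e'. \<Psi> (x, e')))"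

end

theory Submission
  imports Defs "HOL-Library.Ramsey"
begin

text \<open>
  Let \<open>T\<close> be biseparating with inverse \<open>S\<close>. The relation \<open>f \<bottom>\<^sub>h g\<close> only sees where functions differ, so the
  first task is to extract points from it. Say that an open set \<open>U\<close> of \<open>X\<close> and an open set \<open>V\<close> of \<open>Y\<close>
  are linked if some two different functions differ only inside \<open>U\<close> while their images differ only
  inside \<open>V\<close>. This notion is symmetric in \<open>T\<close> and \<open>S\<close>, and it does not depend on the base function:
  if it holds for one \<open>h\<close>, it holds for every \<open>q\<close> in place of \<open>h\<close> (\<open>linked_base_change\<close>).
  Hence, if \<open>T p = T q\<close> on \<open>V\<close>, then \<open>p\<close> and \<open>q\<close> agree somewhere in \<open>U\<close>
  (\<open>linked_agree\<close>). The map \<open>\<phi>\<close> sends \<open>x\<close> to the point \<open>y\<close> all of whose neighbourhoods are linked with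
  all neighbourhoods of \<open>x\<close>. It exists because points \<open>y\<^sub>n\<close> linked with shrinking balls around \<open>x\<close>
  subconverge: otherwise they could be chosen separated, and a function equal to \<open>T e\<close> near infinitely
  many of them and to \<open>T 0\<close> near infinitely many others, for a constant \<open>e \<noteq> 0\<close>, would have a preimage
  with both values \<open>e\<close> and \<open>0\<close> at \<open>x\<close> (\<open>linked_limit\<close>). The same argument gives uniqueness of \<open>y\<close>,
  hence continuity of \<open>\<phi>\<close>, and, applied along a sequence converging to \<open>x\<close>, that \<open>T f (\<phi> x)\<close>
  depends on \<open>f x\<close> only (\<open>agree_at\<close>). So \<open>\<Phi>\<close> and \<open>\<Psi>\<close> can be read off from the constant functions.

  The hardest point is that \<open>\<phi>\<close> is uniformly continuous. Suppose that \<open>d(x\<^sub>n, x'\<^sub>n)\<close> tends to \<open>0\<close>, but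
  \<open>y\<^sub>n = \<phi> x\<^sub>n\<close> and \<open>y'\<^sub>n = \<phi> x'\<^sub>n\<close> stay apart. On the side of \<open>Y\<close>, the values at \<open>y'\<^sub>n\<close> can be changed by
  \<open>O(d\<^sub>\<epsilon>(y\<^sub>n, y'\<^sub>n))\<close>, for any fixed \<open>\<epsilon>\<close> and within the growth of a given uniformly continuous
  function, without changing those at \<open>y\<^sub>n\<close>, and no uniformly continuous function can change more
  than that, for some \<open>\<epsilon>\<close> that depends on it. On the side of \<open>X\<close>, it is exactly the changes
  tending to \<open>0\<close> that are possible at \<open>x'\<^sub>n\<close> alone. But a class of sequences of the form \<open>o(1)\<close> is closed
  under diagonal sequences, whereas the union over \<open>k\<close> of the classes \<open>O(d\<^sub>1\<^sub>/\<^sub>k(y\<^sub>n, y'\<^sub>n))\<close> is not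
  (\<open>dominated_change\<close>, \<open>support_map_unif_cont\<close>).

  The remaining assertions use one construction, a sum of tents over disjoint balls of the chain
  distance (\<open>tents\<close>), and one dichotomy: a sequence in a complete space has a convergent or a separated
  subsequence (\<open>convergent_or_separated\<close>). Convergent sequences account for the continuity of \<open>\<Phi>\<close> at
  accumulation points, separated ones for \<open>u\<close>-continuity. In both cases a uniformly continuous function
  with prescribed values along a subsequence is built and \<open>T\<close> is applied to it. For the converse, the
  dichotomy is applied to a sequence violating the uniform continuity of \<open>T f\<close>; along a
  separated sequence the values of \<open>f\<close> form a \<open>u\<close>-sequence, because \<open>f\<close> is Lipschitz for some \<open>d\<^sub>\<epsilon>\<close> at
  distances bounded below (\<open>unif_cont_u_sequence\<close>).
\<close>

section \<open>Infinite sets of indices\<close>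

text \<open>Subsequences are represented by infinite sets of indices, so that passing to a further subsequence
  is passing to a subset and needs no reindexing.\<close>

abbreviation along :: "nat set \<Rightarrow> nat filter" where
  "along J \<equiv> inf sequentially (principal J)"

lemma eventually_along:
  "eventually P (along J) \<longleftrightarrow> (\<exists>N. \<forall>n\<in>J. n \<ge> N \<longrightarrow> P n)"
  by (auto simp: eventually_inf_principal eventually_sequentially)

lemma along_mono: "J \<subseteq> I \<Longrightarrow> along J \<le> along I"
  by (rule inf_mono) auto

lemma along_nontrivial: "infinite J \<Longrightarrow> along J \<noteq> bot"
  by (auto simp: trivial_limit_def eventually_along infinite_nat_iff_unbounded_le)

lemma eventually_along_ex:
  assumes "eventually P (along J)" "infinite J"
  shows "\<exists>n\<in>J. P n"
  using assms by (auto simp: eventually_along infinite_nat_iff_unbounded_le)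

lemma not_eventually_along:
  assumes "\<not> eventually P (along J)"
  shows "infinite {n\<in>J. \<not> P n}"
  using assms unfolding eventually_along infinite_nat_iff_unbounded_le by auto

lemma eventually_along_infinite:
  assumes "eventually P (along J)" "infinite J"
  shows "infinite {n\<in>J. P n}"
  using assms unfolding eventually_along infinite_nat_iff_unbounded_le
  by clarsimp (metis max.bounded_iff nat_le_linear)

lemma tendsto_along_mono:
  "(f \<longlongrightarrow> l) (along I) \<Longrightarrow> J \<subseteq> I \<Longrightarrow> (f \<longlongrightarrow> l) (along J)"
  using tendsto_mono along_mono by blast

lemma along_UNIV [simp]: "along UNIV = sequentially"
  by (simp add: inf_absorb1)

lemma tendsto_along: "f \<longlonglongrightarrow> l \<Longrightarrow> (f \<longlongrightarrow> l) (along J)"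
  by (rule tendsto_mono[OF inf_le1])

lemma not_tendsto_along:
  assumes "\<not> ((a::nat \<Rightarrow> real) \<longlongrightarrow> 0) (along I)" "\<And>n. 0 \<le> a n"
  obtains J \<epsilon> where "J \<subseteq> I" "infinite J" "0 < \<epsilon>" "\<And>n. n \<in> J \<Longrightarrow> \<epsilon> \<le> a n"
proof -
  obtain \<epsilon> where \<epsilon>: "0 < \<epsilon>" "\<not> (\<forall>\<^sub>F n in along I. dist (a n) 0 < \<epsilon>)"
    using assms(1) unfolding tendsto_iff by blast
  show thesis
    by (rule that[OF _ not_eventually_along[OF \<epsilon>(2)] \<epsilon>(1)]) (use assms(2) in auto)
qed

lemma infinite_split:
  fixes J :: "nat set"
  assumes "infinite J"
  obtains K where "K \<subseteq> J" "infinite K" "infinite (J - K)"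
proof
  let ?e = "enumerate J"
  have inj: "inj ?e" using assms by (simp add: strict_mono_enumerate strict_mono_imp_inj_on)
  have r: "range ?e = J" using assms by (simp add: range_enumerate)
  show "?e ` {n. even n} \<subseteq> J" using r by auto
  have "\<exists>n\<ge>m. even n" "\<exists>n\<ge>m. odd n" for m :: nat
    by (rule exI[of _ "2 * m"], simp) (rule exI[of _ "Suc (2 * m)"], simp)
  then have "infinite {n::nat. even n}" "infinite {n::nat. odd n}"
    unfolding infinite_nat_iff_unbounded_le by auto
  then show "infinite (?e ` {n. even n})"
    using finite_imageD inj inj_on_subset by blast
  have "?e ` {n. odd n} \<subseteq> J - ?e ` {n. even n}"
    using r inj by (auto simp: inj_eq)
  then show "infinite (J - ?e ` {n. even n})"
    using \<open>infinite {n. odd n}\<close> finite_imageD inj inj_on_subset finite_subset by (metis subset_UNIV)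
qed

text \<open>Ramsey's theorem for pairs, as a dichotomy for relations on \<open>m < n\<close>. With \<open>P m n\<close> a growth
  condition from \<open>m\<close> to \<open>n\<close>, the first case is rapid growth and the second one bounds the sequence by
  its first term.\<close>

lemma infinite_homogeneous_subset:
  fixes I :: "nat set" and P :: "nat \<Rightarrow> nat \<Rightarrow> bool"
  assumes "infinite I"
  obtains (all) J where "J \<subseteq> I" "infinite J" "\<And>m n. m \<in> J \<Longrightarrow> n \<in> J \<Longrightarrow> m < n \<Longrightarrow> P m n"
  | (none) J where "J \<subseteq> I" "infinite J" "\<And>m n. m \<in> J \<Longrightarrow> n \<in> J \<Longrightarrow> m < n \<Longrightarrow> \<not> P m n"
proof -
  define c where "c S = (if P (Min S) (Max S) then 0 else 1::nat)" for S
  have "\<forall>x\<in>I. \<forall>y\<in>I. x \<noteq> y \<longrightarrow> c {x, y} < 2" by (simp add: c_def)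
  from Ramsey2[OF assms this] obtain J t where J: "J \<subseteq> I" "infinite J"
    "\<forall>x\<in>J. \<forall>y\<in>J. x \<noteq> y \<longrightarrow> c {x, y} = t" by blast
  have "c {m, n} = (if P m n then 0 else 1)" if "m < n" for m n
    using that by (simp add: c_def)
  then have "(\<forall>m\<in>J. \<forall>n\<in>J. m < n \<longrightarrow> P m n) \<or> (\<forall>m\<in>J. \<forall>n\<in>J. m < n \<longrightarrow> \<not> P m n)"
    using J(3) by (metis nat_neq_iff zero_neq_one)
  then show thesis using J(1,2) all[of J] none[of J] by metis
qed

definition separated_on :: "real \<Rightarrow> (nat \<Rightarrow> 'a::metric_space) \<Rightarrow> nat set \<Rightarrow> bool" where
  "separated_on s z J \<longleftrightarrow> (\<forall>m\<in>J. \<forall>n\<in>J. m \<noteq> n \<longrightarrow> s \<le> dist (z m) (z n))"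

lemma separated_on_subset: "separated_on s z I \<Longrightarrow> J \<subseteq> I \<Longrightarrow> separated_on s z J"
  by (auto simp: separated_on_def)

text \<open>If the set of values is totally bounded, its closure is compact by completeness. Otherwise some
  \<open>e\<close> admits no finite cover by \<open>e\<close>-balls, and indices can be chosen greedily, each value at distance at
  least \<open>e\<close> from all values up to the previous index.\<close>

lemma convergent_or_separated:
  fixes z :: "nat \<Rightarrow> 'a::complete_space"
  assumes I: "infinite I"
  obtains (convergent) J l where "J \<subseteq> I" "infinite J" "(z \<longlongrightarrow> l) (along J)"
  | (separated) J s where "J \<subseteq> I" "infinite J" "0 < s" "separated_on s z J"
proof (cases "\<forall>e>0. \<exists>k. finite k \<and> z ` I \<subseteq> (\<Union>x\<in>k. ball x e)")
  case True
  have "compact (closure (z ` I))"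
    unfolding compact_eq_totally_bounded
  proof (intro conjI allI impI)
    show "complete (closure (z ` I))" by (simp add: complete_eq_closed)
    fix e :: real assume "0 < e"
    with True obtain k where k: "finite k" "z ` I \<subseteq> (\<Union>x\<in>k. ball x (e/2))"
      by (meson half_gt_zero)
    have "closure (z ` I) \<subseteq> (\<Union>x\<in>k. cball x (e/2))"
      by (rule closure_minimal)
         (use k in \<open>auto intro!: closed_UN simp: subset_eq, metis less_imp_le mem_ball\<close>)
    also have "\<dots> \<subseteq> (\<Union>x\<in>k. ball x e)" using \<open>0 < e\<close> by fastforce
    finally show "\<exists>k. finite k \<and> closure (z ` I) \<subseteq> (\<Union>x\<in>k. ball x e)" using k by blast
  qed
  moreover have "\<forall>n. (z \<circ> enumerate I) n \<in> closure (z ` I)"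
    using closure_subset enumerate_in_set[OF I] by fastforce
  ultimately obtain l r where r: "strict_mono r" "((z \<circ> enumerate I) \<circ> r) \<longlonglongrightarrow> l"
    unfolding compact_def by blast
  let ?q = "enumerate I \<circ> r"
  have q: "strict_mono ?q" using r(1) I by (simp add: strict_mono_enumerate strict_mono_o)
  have "(z \<longlongrightarrow> l) (along (range ?q))"
  proof (rule tendstoI)
    fix e :: real assume "0 < e"
    then obtain N where N: "\<forall>n\<ge>N. dist (z (?q n)) l < e"
      using r(2) by (auto simp: lim_sequentially)
    show "\<forall>\<^sub>F n in along (range ?q). dist (z n) l < e"
      unfolding eventually_along
      by (rule exI[of _ "?q N"]) (use N q in \<open>auto simp: strict_mono_less_eq simp del: o_apply\<close>)
  qed
  moreover have "infinite (range ?q)" by (intro range_inj_infinite strict_mono_imp_inj_on q)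
  moreover have "range ?q \<subseteq> I" using enumerate_in_set[OF I] by auto
  ultimately show thesis using convergent[of "range ?q" l] by blast
next
  case False
  then obtain e where e: "0 < e" "\<And>k. finite k \<Longrightarrow> \<not> z ` I \<subseteq> (\<Union>x\<in>k. ball x e)" by blast
  have ex: "\<exists>n\<in>I. \<forall>m\<le>N. e \<le> dist (z m) (z n)" for N
    using e(2)[of "z ` {..N}"] by (auto simp: subset_eq not_less)
  define next_index where "next_index N = (SOME n. n \<in> I \<and> (\<forall>m\<le>N. e \<le> dist (z m) (z n)))" for N
  have nx: "next_index N \<in> I" "\<And>m. m \<le> N \<Longrightarrow> e \<le> dist (z m) (z (next_index N))" for N
    using someI_ex[OF ex[of N, unfolded Bex_def]] by (auto simp: next_index_def)
  have gt: "N < next_index N" for N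
    using nx(2)[of "next_index N" N] e(1) by (auto simp: not_le[symmetric])
  define q where "q k = (next_index ^^ (Suc k)) 0" for k
  have qS: "q (Suc k) = next_index (q k)" for k by (simp add: q_def)
  have q: "strict_mono q" by (simp add: strict_mono_Suc_iff qS gt)
  have qI: "q k \<in> I" for k using nx(1) by (simp add: q_def)
  have far: "e \<le> dist (z (q i)) (z (q j))" if "i < j" for i j
  proof -
    obtain k where "j = Suc k" "i \<le> k" using \<open>i < j\<close> by (cases j) auto
    then show ?thesis using nx(2)[of "q i" "q k"] q by (simp add: qS strict_mono_less_eq)
  qed
  then have "separated_on e z (range q)"
    unfolding separated_on_def by (metis (mono_tags) dist_commute linorder_neqE_nat rangeE)
  moreover have "infinite (range q)" using q by (simp add: range_inj_infinite strict_mono_imp_inj_on)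
  ultimately show thesis using separated qI e(1) by (metis image_subsetI)
qed

lemma tendsto_0_if_less_inverse_Suc:
  assumes "\<And>n. 0 \<le> a n" "\<And>n. a n < 1 / real (Suc n)"
  shows "a \<longlonglongrightarrow> 0"
  by (rule real_tendsto_sandwich[OF _ _ tendsto_const LIMSEQ_Suc[OF lim_1_over_n]])
    (use assms in \<open>auto intro!: always_eventually less_imp_le\<close>)

lemma tendsto_close:
  fixes x x' :: "nat \<Rightarrow> 'a::metric_space"
  assumes "(x \<longlongrightarrow> l) F" "((\<lambda>n. dist (x n) (x' n)) \<longlongrightarrow> 0) F"
  shows "(x' \<longlongrightarrow> l) F"
proof -
  have "((\<lambda>n. dist (x n) (x' n) + dist (x n) l) \<longlongrightarrow> 0 + 0) F"
    using assms tendsto_dist_iff by (intro tendsto_add) auto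
  then have lim: "((\<lambda>n. dist (x n) (x' n) + dist (x n) l) \<longlongrightarrow> 0) F" by simp
  have "((\<lambda>n. dist (x' n) l) \<longlongrightarrow> 0) F"
  proof (rule Lim_null_comparison[OF always_eventually lim], rule allI)
    fix n show "norm (dist (x' n) l) \<le> dist (x n) (x' n) + dist (x n) l"
      using dist_triangle[of "x' n" l "x n"] by (simp add: dist_commute)
  qed
  then show ?thesis using tendsto_dist_iff by blast
qed

lemma separated_seq_iff: "separated_seq z \<longleftrightarrow> (\<exists>s>0. separated_on s z UNIV)"
proof
  assume pos: "separated_seq z"
  let ?s = "INF (n, m)\<in>{(n, m). n \<noteq> m}. dist (z n) (z m)"
  have "?s \<le> dist (z m) (z n)" if "m \<noteq> n" for m n
    using cINF_lower[of "\<lambda>(n, m). dist (z n) (z m)" "{(n, m). n \<noteq> m}" "(m, n)"] that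
    by (force intro!: bdd_belowI2[of _ 0])
  then show "\<exists>s>0. separated_on s z UNIV"
    using pos unfolding separated_seq_def separated_on_def by blast
next
  assume "\<exists>s>0. separated_on s z UNIV"
  then obtain s where s: "0 < s" "\<And>m n. m \<noteq> n \<Longrightarrow> s \<le> dist (z m) (z n)" by (auto simp: separated_on_def)
  have "(0::nat, 1::nat) \<in> {(n, m). n \<noteq> m}" by simp
  then have "s \<le> (INF (n, m)\<in>{(n, m). n \<noteq> m}. dist (z n) (z m))"
    by (intro cINF_greatest) (use s(2) in auto)
  then show "separated_seq z" using s(1) by (simp add: separated_seq_def)
qed

section \<open>Chain distances and uniformly continuous maps\<close>

lemma chain_dist_le_sum:
  fixes z :: "nat \<Rightarrow> 'a::metric_space"
  assumes "z 0 = a" "z n = b" "\<And>i. i \<in> {1..n} \<Longrightarrow> dist (z (i - 1)) (z i) \<le> \<epsilon>"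
  shows "chain_dist \<epsilon> a b \<le> ereal (\<Sum>i=1..n. dist (z (i - 1)) (z i))"
  unfolding chain_dist_def using assms
  by (intro Inf_lower CollectI exI[of _ n] exI[of _ z]) (auto simp del: One_nat_def)

lemma chain_dist_ge:
  assumes "\<And>(n::nat) z. z 0 = a \<Longrightarrow> z n = b \<Longrightarrow> (\<And>i. i \<in> {1..n} \<Longrightarrow> dist (z (i - 1)) (z i) \<le> \<epsilon>)
     \<Longrightarrow> c \<le> ereal (\<Sum>i=1..n. dist (z (i - 1)) (z i))"
  shows "c \<le> chain_dist \<epsilon> a b"
  unfolding chain_dist_def using assms
  by (intro Inf_greatest) blast

lemma dist_le_chain_dist: "ereal (dist a b) \<le> chain_dist \<epsilon> a b"
proof (rule chain_dist_ge)
  fix n and z :: "nat \<Rightarrow> 'a" assume "z 0 = a" "z n = b"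
  moreover have "dist (z 0) (z n) \<le> (\<Sum>i=1..n. dist (z (i - 1)) (z i))"
  proof (induction n)
    case (Suc n)
    have "dist (z 0) (z (Suc n)) \<le> dist (z 0) (z n) + dist (z n) (z (Suc n))" by (rule dist_triangle)
    then show ?case using Suc by simp
  qed simp
  ultimately show "ereal (dist a b) \<le> ereal (\<Sum>i=1..n. dist (z (i - 1)) (z i))" by simp
qed

lemma chain_dist_nonneg: "0 \<le> chain_dist \<epsilon> a b"
  using dist_le_chain_dist[of a b \<epsilon>] by (metis ereal_less_eq(5) order_trans zero_le_dist)

lemma chain_dist_self [simp]: "chain_dist \<epsilon> a a = 0"
proof (rule order_antisym)
  have "chain_dist \<epsilon> a a \<le> ereal (\<Sum>i=1..0::nat. dist a a)"
    by (rule chain_dist_le_sum[where z = "\<lambda>_. a"]) auto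
  then show "chain_dist \<epsilon> a a \<le> 0" by (simp add: zero_ereal_def)
qed (rule chain_dist_nonneg)

lemma chain_dist_antimono: "\<delta> \<le> \<epsilon> \<Longrightarrow> chain_dist \<epsilon> a b \<le> chain_dist \<delta> a b"
  by (intro chain_dist_ge chain_dist_le_sum) (auto intro: order_trans)

lemma chain_dist_commute: "chain_dist \<epsilon> a b = chain_dist \<epsilon> b a"
proof -
  have "chain_dist \<epsilon> a b \<le> chain_dist \<epsilon> b a" for a b :: 'a
  proof (rule chain_dist_ge)
    fix n and z :: "nat \<Rightarrow> 'a"
    assume z: "z 0 = b" "z n = a" "\<And>i. i \<in> {1..n} \<Longrightarrow> dist (z (i - 1)) (z i) \<le> \<epsilon>"
    have eq: "dist (z (n - (i - 1))) (z (n - i)) = dist (z (n + 1 - i - 1)) (z (n + 1 - i))"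
      if "i \<in> {1..n}" for i
      using that by (simp add: dist_commute Suc_diff_le)
    have "chain_dist \<epsilon> a b \<le> ereal (\<Sum>i=1..n. dist (z (n - (i - 1))) (z (n - i)))"
    proof (rule chain_dist_le_sum[where z = "\<lambda>i. z (n - i)"])
      fix i assume i: "i \<in> {1..n}"
      then show "dist (z (n - (i - 1))) (z (n - i)) \<le> \<epsilon>"
        unfolding eq[OF i] by (intro z(3)) auto
    qed (use z in auto)
    also have "(\<Sum>i=1..n. dist (z (n - (i - 1))) (z (n - i)))
        = (\<Sum>i=1..n. dist (z (n + 1 - i - 1)) (z (n + 1 - i)))"
      using eq by (intro sum.cong) auto
    also have "\<dots> = (\<Sum>i=1..n. dist (z (i - 1)) (z i))"
      by (rule sum.reindex_bij_witness[where i = "\<lambda>i. n + 1 - i" and j = "\<lambda>i. n + 1 - i"]) auto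
    finally show "chain_dist \<epsilon> a b \<le> ereal (\<Sum>i=1..n. dist (z (i - 1)) (z i))" .
  qed
  then show ?thesis by (simp add: order_antisym)
qed

lemma chain_dist_step:
  assumes "dist b c \<le> \<epsilon>"
  shows "chain_dist \<epsilon> a c \<le> chain_dist \<epsilon> a b + ereal (dist b c)"
proof -
  have "chain_dist \<epsilon> a c - ereal (dist b c) \<le> chain_dist \<epsilon> a b"
  proof (rule chain_dist_ge)
    fix n and z :: "nat \<Rightarrow> 'a"
    assume z: "z 0 = a" "z n = b" "\<And>i. i \<in> {1..n} \<Longrightarrow> dist (z (i - 1)) (z i) \<le> \<epsilon>"
    let ?z = "z(Suc n := c)"
    have "chain_dist \<epsilon> a c \<le> ereal (\<Sum>i=1..Suc n. dist (?z (i - 1)) (?z i))"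
      by (rule chain_dist_le_sum) (use z assms in \<open>auto simp: le_Suc_eq\<close>)
    also have "(\<Sum>i=1..Suc n. dist (?z (i - 1)) (?z i)) = (\<Sum>i=1..n. dist (z (i - 1)) (z i)) + dist b c"
      using z(2) by (auto intro!: sum.cong)
    finally show "chain_dist \<epsilon> a c - ereal (dist b c) \<le> ereal (\<Sum>i=1..n. dist (z (i - 1)) (z i))"
      by (simp add: ereal_minus_le)
  qed
  then show ?thesis by (simp add: ereal_minus_le)
qed

lemma chain_dist_triangle:
  "chain_dist \<epsilon> a c \<le> chain_dist \<epsilon> a b + chain_dist \<epsilon> b c"
proof (cases "chain_dist \<epsilon> a b")
  case (real r)
  have "chain_dist \<epsilon> a c - chain_dist \<epsilon> a b \<le> chain_dist \<epsilon> b c"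
  proof (rule chain_dist_ge)
    fix n and z :: "nat \<Rightarrow> 'a"
    assume z: "z 0 = b" "z n = c" and le: "\<And>i. i \<in> {1..n} \<Longrightarrow> dist (z (i - 1)) (z i) \<le> \<epsilon>"
    have "chain_dist \<epsilon> a (z n) \<le> chain_dist \<epsilon> a b + ereal (\<Sum>i=1..n. dist (z (i - 1)) (z i))"
      using le
    proof (induction n)
      case (Suc n)
      have "chain_dist \<epsilon> a (z (Suc n)) \<le> chain_dist \<epsilon> a (z n) + ereal (dist (z n) (z (Suc n)))"
        using Suc.prems[of "Suc n"] by (intro chain_dist_step) auto
      also have "\<dots> \<le> (chain_dist \<epsilon> a b + ereal (\<Sum>i=1..n. dist (z (i - 1)) (z i)))
          + ereal (dist (z n) (z (Suc n)))"
        using Suc by (intro add_right_mono) auto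
      finally show ?case by (simp add: add.assoc)
    qed (use z in simp)
    then show "chain_dist \<epsilon> a c - chain_dist \<epsilon> a b \<le> ereal (\<Sum>i=1..n. dist (z (i - 1)) (z i))"
      using z real by (simp add: ereal_minus_le add.commute)
  qed
  then show ?thesis using real by (simp add: ereal_minus_le add.commute)
next
  case PInf
  then show ?thesis using chain_dist_nonneg[of \<epsilon> b c] by simp
next
  case MInf
  then show ?thesis using chain_dist_nonneg[of \<epsilon> a b] by simp
qed

lemma unif_cont_mapsD:
  assumes "f \<in> unif_cont_maps" "0 < \<epsilon>"
  obtains \<delta> where "0 < \<delta>" "\<And>x y. dist x y < \<delta> \<Longrightarrow> norm (f x - f y) < \<epsilon>"
proof -
  from assms obtain \<delta> where "0 < \<delta>" "\<And>x y. dist y x < \<delta> \<Longrightarrow> dist (f y) (f x) < \<epsilon>"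
    unfolding unif_cont_maps_def uniformly_continuous_on_def by blast
  then show thesis using that[of \<delta>] by (simp add: dist_norm)
qed

lemma unif_cont_mapsI:
  assumes "\<And>\<epsilon>. 0 < \<epsilon> \<Longrightarrow> \<exists>\<delta>>0. \<forall>x y. dist x y < \<delta> \<longrightarrow> norm (f x - f y) < \<epsilon>"
  shows "f \<in> unif_cont_maps"
  using assms unfolding unif_cont_maps_def uniformly_continuous_on_def
  by (simp add: dist_norm) (meson dist_commute norm_minus_commute)

lemma unif_cont_const: "(\<lambda>_. c) \<in> unif_cont_maps"
  by (simp add: unif_cont_maps_def uniformly_continuous_on_const)

lemma unif_cont_add:
  "f \<in> unif_cont_maps \<Longrightarrow> g \<in> unif_cont_maps \<Longrightarrow> (\<lambda>x. f x + g x) \<in> unif_cont_maps"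
  by (simp add: unif_cont_maps_def uniformly_continuous_on_add)

lemma unif_cont_diff:
  "f \<in> unif_cont_maps \<Longrightarrow> g \<in> unif_cont_maps \<Longrightarrow> (\<lambda>x. f x - g x) \<in> unif_cont_maps"
  by (simp add: unif_cont_maps_def uniformly_continuous_on_diff)

lemma unif_cont_isCont: "f \<in> unif_cont_maps \<Longrightarrow> isCont f x"
  unfolding unif_cont_maps_def
  using uniformly_continuous_imp_continuous continuous_on_eq_continuous_at open_UNIV by blast

lemma unif_cont_compose:
  assumes "f \<in> unif_cont_maps" "uniformly_continuous_on UNIV \<theta>"
  shows "(\<lambda>x. f (\<theta> x)) \<in> unif_cont_maps"
proof -
  have "uniformly_continuous_on (range \<theta>) f"
    using assms(1) unfolding unif_cont_maps_def uniformly_continuous_on_def by blast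
  then show ?thesis
    using uniformly_continuous_on_compose[OF assms(2)] by (simp add: unif_cont_maps_def)
qed

lemma unif_cont_along:
  assumes "f \<in> unif_cont_maps" "((\<lambda>n. dist (x n) (x' n)) \<longlongrightarrow> 0) F"
  shows "((\<lambda>n. norm (f (x n) - f (x' n))) \<longlongrightarrow> 0) F"
proof (rule tendstoI)
  fix \<epsilon> :: real assume "0 < \<epsilon>"
  then obtain \<delta> where \<delta>: "0 < \<delta>" "\<And>x y. dist x y < \<delta> \<Longrightarrow> norm (f x - f y) < \<epsilon>"
    using unif_cont_mapsD[OF assms(1)] by blast
  have "\<forall>\<^sub>F n in F. dist (x n) (x' n) < \<delta>" by (rule order_tendstoD(2)[OF assms(2) \<delta>(1)])
  then show "\<forall>\<^sub>F n in F. dist (norm (f (x n) - f (x' n))) 0 < \<epsilon>"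
    by (rule eventually_mono) (use \<delta>(2) in simp)
qed

text \<open>A chain of small steps can be cut into blocks of length about \<open>\<delta>\<close>, over each of which \<open>f\<close> changes by
  less than \<open>1\<close>; the number of blocks is at most the length of the chain divided by \<open>\<delta>\<close>, up to an
  incomplete last one, which accounts for the summand \<open>1\<close>.\<close>

lemma unif_cont_norm_le_chain_dist:
  assumes "f \<in> unif_cont_maps"
  obtains \<delta> C where "0 < \<delta>" "0 < C"
    "\<And>a b. ereal (norm (f a - f b)) \<le> 1 + ereal C * chain_dist \<delta> a b"
proof -
  obtain \<eta> where \<eta>: "0 < \<eta>" "\<And>x y. dist x y < \<eta> \<Longrightarrow> norm (f x - f y) < 1"
    using unif_cont_mapsD[OF assms, of 1] by auto
  define \<delta> where "\<delta> = \<eta> / 3"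
  have \<delta>: "0 < \<delta>" "2 * \<delta> < \<eta>" using \<eta>(1) by (auto simp: \<delta>_def)
  have "ereal (norm (f a - f b)) \<le> 1 + ereal (1/\<delta>) * chain_dist \<delta> a b" for a b
  proof -
    have "ereal (\<delta> * (norm (f a - f b) - 1)) \<le> chain_dist \<delta> a b"
    proof (rule chain_dist_ge)
      fix n and z :: "nat \<Rightarrow> 'a"
      assume z: "z 0 = a" "z n = b" and le: "\<And>i. i \<in> {1..n} \<Longrightarrow> dist (z (i - 1)) (z i) \<le> \<delta>"
      define S where "S n = (\<Sum>i=1..n. dist (z (i - 1)) (z i))" for n
      \<comment> \<open>Steps are collected greedily into blocks of length more than \<open>\<delta>\<close>; \<open>p\<close> is the end of the
        last complete block and \<open>s\<close> the length of the steps after it.\<close>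
      have "\<exists>p s. 0 \<le> s \<and> s \<le> \<delta> \<and> dist p (z n) \<le> s \<and> \<delta> * norm (f a - f p) \<le> S n - s"
        using le
      proof (induction n)
        case 0
        show ?case by (rule exI[of _ a], rule exI[of _ 0]) (use z \<delta> in \<open>simp add: S_def\<close>)
      next
        case (Suc n)
        then obtain p s where p: "0 \<le> s" "s \<le> \<delta>" "dist p (z n) \<le> s" "\<delta> * norm (f a - f p) \<le> S n - s"
          by force
        define t where "t = dist (z n) (z (Suc n))"
        have t: "0 \<le> t" "t \<le> \<delta>" using Suc.prems[of "Suc n"] by (auto simp: t_def)
        have S: "S (Suc n) = S n + t" by (simp add: S_def t_def)
        have d: "dist p (z (Suc n)) \<le> s + t"
          using p(3) dist_triangle[of p "z (Suc n)" "z n"] by (simp add: t_def)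
        show ?case
        proof (cases "s + t \<le> \<delta>")
          case True
          then show ?thesis using p t S d by (intro exI[of _ p] exI[of _ "s + t"]) auto
        next
          case False
          have "norm (f p - f (z (Suc n))) < 1" using d p(2) t(2) \<delta> by (intro \<eta>(2)) linarith
          moreover have "norm (f a - f (z (Suc n))) \<le> norm (f a - f p) + norm (f p - f (z (Suc n)))"
            by (metis diff_add_cancel add_diff_eq norm_triangle_ineq)
          ultimately have "\<delta> * norm (f a - f (z (Suc n))) \<le> \<delta> * (norm (f a - f p) + 1)"
            using \<delta>(1) by (intro mult_left_mono) auto
          then show ?thesis
            using p(4) False S \<delta>(1)
            by (intro exI[of _ "z (Suc n)"] exI[of _ 0]) (simp add: algebra_simps)
        qed
      qed
      then obtain p s where p: "0 \<le> s" "s \<le> \<delta>" "dist p b \<le> s" "\<delta> * norm (f a - f p) \<le> S n - s"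
        using z by auto
      have "norm (f p - f b) < 1" using p \<delta> by (intro \<eta>(2)) linarith
      moreover have "norm (f a - f b) \<le> norm (f a - f p) + norm (f p - f b)"
        by (metis diff_add_cancel add_diff_eq norm_triangle_ineq)
      ultimately have "\<delta> * (norm (f a - f b) - 1) \<le> \<delta> * norm (f a - f p)"
        using \<delta>(1) by (intro mult_left_mono) auto
      then show "ereal (\<delta> * (norm (f a - f b) - 1)) \<le> ereal (\<Sum>i=1..n. dist (z (i - 1)) (z i))"
        using p by (simp add: S_def)
    qed
    then show ?thesis
      using \<delta>(1) by (cases "chain_dist \<delta> a b") (auto simp: field_simps one_ereal_def)
  qed
  then show thesis using that[of \<delta> "1/\<delta>"] \<delta>(1) by auto
qed

section \<open>Construction of uniformly continuous maps\<close>

text \<open>The balls are taken for the chain distance: uniformly continuous functions with large values at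
  the centres need radii much larger than the scale \<open>\<delta>\<close>, and a tent of slope \<open>C\<close> for the chain
  distance is still \<open>C\<close>-Lipschitz at distances up to \<open>\<delta>\<close>.\<close>

definition disjoint_chain_balls ::
  "real \<Rightarrow> (nat \<Rightarrow> 'a::metric_space) \<Rightarrow> (nat \<Rightarrow> real) \<Rightarrow> nat set \<Rightarrow> bool" where
  "disjoint_chain_balls \<delta> z \<rho> I \<longleftrightarrow> (\<forall>i\<in>I. 0 < \<rho> i) \<and>
     (\<forall>i\<in>I. \<forall>j\<in>I. i \<noteq> j \<longrightarrow> ereal (\<rho> i + \<rho> j) \<le> chain_dist \<delta> (z i) (z j))"

text \<open>Tents with heights \<open>h i\<close> over balls of radii \<open>\<rho> i\<close> are equi-uniformly continuous under this
  condition: those higher than \<open>\<epsilon>\<close> have bounded slope. It covers both heights proportional to the radii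
  and heights tending to \<open>0\<close> over arbitrarily small balls.\<close>

definition admissible_heights :: "(nat \<Rightarrow> real) \<Rightarrow> (nat \<Rightarrow> real) \<Rightarrow> nat set \<Rightarrow> bool" where
  "admissible_heights h \<rho> I \<longleftrightarrow> (\<forall>\<epsilon>>0. \<exists>C\<ge>0. \<forall>i\<in>I. h i \<le> max \<epsilon> (C * \<rho> i))"

lemma disjoint_chain_balls_subset:
  "disjoint_chain_balls \<delta> z \<rho> I \<Longrightarrow> J \<subseteq> I \<Longrightarrow> disjoint_chain_balls \<delta> z \<rho> J"
  unfolding disjoint_chain_balls_def by blast

lemma chain_balls_disjoint:
  assumes "disjoint_chain_balls \<delta> z \<rho> I" "i \<in> I" "j \<in> I" "i \<noteq> j"
  shows "{y. chain_dist \<delta> (z i) y < ereal (\<rho> i)} \<inter> {y. chain_dist \<delta> (z j) y < ereal (\<rho> j)} = {}"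
proof (rule ccontr)
  assume "\<not> ?thesis"
  then obtain y where y: "chain_dist \<delta> (z i) y < ereal (\<rho> i)" "chain_dist \<delta> (z j) y < ereal (\<rho> j)" by blast
  have "chain_dist \<delta> (z i) (z j) \<le> chain_dist \<delta> (z i) y + chain_dist \<delta> (z j) y"
    using chain_dist_triangle chain_dist_commute by metis
  also have "\<dots> < ereal (\<rho> i) + ereal (\<rho> j)"
    using y chain_dist_nonneg[of \<delta> "z i" y] chain_dist_nonneg[of \<delta> "z j" y]
    by (intro ereal_add_strict_mono2) auto
  also have "\<dots> \<le> chain_dist \<delta> (z i) (z j)"
    using assms by (auto simp: disjoint_chain_balls_def)
  finally show False by simp
qed

lemma disjoint_chain_balls_if_dist:
  assumes "\<And>i. i \<in> I \<Longrightarrow> 0 < \<rho> i"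
    "\<And>i j. i \<in> I \<Longrightarrow> j \<in> I \<Longrightarrow> i < j \<Longrightarrow> \<rho> i + \<rho> j \<le> dist (z i) (z j)"
  shows "disjoint_chain_balls \<delta> z \<rho> I"
  unfolding disjoint_chain_balls_def
proof (intro conjI ballI impI)
  fix i j assume "i \<in> I" "j \<in> I" "i \<noteq> j"
  then have "\<rho> i + \<rho> j \<le> dist (z i) (z j)"
    using assms(2)[of i j] assms(2)[of j i] by (cases "i < j") (auto simp: dist_commute add.commute)
  then show "ereal (\<rho> i + \<rho> j) \<le> chain_dist \<delta> (z i) (z j)"
    using dist_le_chain_dist order_trans ereal_less_eq(3) by blast
qed (use assms in auto)

lemma admissible_heights_linear:
  assumes "\<And>i. i \<in> I \<Longrightarrow> h i \<le> C * \<rho> i" "\<And>i. i \<in> I \<Longrightarrow> 0 < \<rho> i"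
  shows "admissible_heights h \<rho> I"
  unfolding admissible_heights_def
proof (intro allI impI exI[of _ "max C 0"] conjI ballI)
  fix i \<epsilon> assume "i \<in> I"
  then have "C * \<rho> i \<le> max C 0 * \<rho> i" using assms(2)[of i] by (intro mult_right_mono) auto
  then show "h i \<le> max \<epsilon> (max C 0 * \<rho> i)" using assms(1)[OF \<open>i \<in> I\<close>] by linarith
qed auto

lemma admissible_heights_null:
  assumes "(h \<longlongrightarrow> 0) (along I)" "\<And>i. i \<in> I \<Longrightarrow> 0 < \<rho> i"
  shows "admissible_heights h \<rho> I"
  unfolding admissible_heights_def
proof (intro allI impI)
  fix \<epsilon> :: real assume "0 < \<epsilon>"
  then have "\<forall>\<^sub>F n in along I. h n < \<epsilon>" by (rule order_tendstoD(2)[OF assms(1)])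
  then obtain N where N: "\<And>n. n \<in> I \<Longrightarrow> N \<le> n \<Longrightarrow> h n < \<epsilon>" by (auto simp: eventually_along)
  define C where "C = (\<Sum>i\<in>I \<inter> {..<N}. \<bar>h i\<bar> / \<rho> i)"
  have "h i \<le> max \<epsilon> (C * \<rho> i)" if "i \<in> I" for i
  proof (cases "N \<le> i")
    case True
    then show ?thesis using N[OF \<open>i \<in> I\<close>] by auto
  next
    case False
    have "\<bar>h i\<bar> / \<rho> i \<le> C" unfolding C_def
      by (rule member_le_sum) (use False \<open>i \<in> I\<close> assms(2) in \<open>auto simp: less_imp_le\<close>)
    then have "\<bar>h i\<bar> \<le> C * \<rho> i" using assms(2)[OF \<open>i \<in> I\<close>] by (simp add: pos_divide_le_eq)
    then show ?thesis by auto
  qed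
  moreover have "0 \<le> C" unfolding C_def using assms(2) by (intro sum_nonneg) (auto simp: less_imp_le)
  ultimately show "\<exists>C\<ge>0. \<forall>i\<in>I. h i \<le> max \<epsilon> (C * \<rho> i)" by blast
qed

text \<open>The cap makes the chain distance finite without affecting the balls of radius up to \<open>r\<close>.\<close>

definition capped_chain_dist :: "real \<Rightarrow> real \<Rightarrow> 'a::metric_space \<Rightarrow> 'a \<Rightarrow> real" where
  "capped_chain_dist \<delta> r a y = real_of_ereal (min (ereal r) (chain_dist \<delta> a y))"

lemma ereal_capped_chain_dist:
  assumes "0 \<le> r"
  shows "ereal (capped_chain_dist \<delta> r a y) = min (ereal r) (chain_dist \<delta> a y)"
  using chain_dist_nonneg[of \<delta> a y] assms
  by (cases "chain_dist \<delta> a y") (auto simp: capped_chain_dist_def min_def)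

lemma capped_chain_dist_bounds:
  assumes "0 \<le> r"
  shows "0 \<le> capped_chain_dist \<delta> r a y" "capped_chain_dist \<delta> r a y \<le> r"
  using chain_dist_nonneg[of \<delta> a y] assms
  by (cases "chain_dist \<delta> a y"; auto simp: capped_chain_dist_def min_def)+

lemma capped_chain_dist_lipschitz:
  assumes "0 \<le> r" "dist y y' \<le> \<delta>"
  shows "\<bar>capped_chain_dist \<delta> r a y - capped_chain_dist \<delta> r a y'\<bar> \<le> dist y y'"
proof -
  have *: "capped_chain_dist \<delta> r a y \<le> capped_chain_dist \<delta> r a y' + dist y y'"
    if "dist y y' \<le> \<delta>" for y y'
  proof -
    have "chain_dist \<delta> a y \<le> chain_dist \<delta> a y' + ereal (dist y' y)"
      by (rule chain_dist_step) (use that in \<open>simp add: dist_commute\<close>)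
    then have "min (ereal r) (chain_dist \<delta> a y) \<le> min (ereal r) (chain_dist \<delta> a y') + ereal (dist y y')"
      using chain_dist_nonneg[of \<delta> a y] chain_dist_nonneg[of \<delta> a y'] zero_le_dist[of y' y]
      by (cases "chain_dist \<delta> a y"; cases "chain_dist \<delta> a y'")
        (auto simp: min_def dist_commute simp del: zero_le_dist)
    then show ?thesis
      unfolding ereal_capped_chain_dist[OF assms(1), symmetric] by simp
  qed
  show ?thesis using *[of y y'] *[of y' y] assms(2) by (auto simp: dist_commute)
qed

text \<open>The sum of the tents \<open>(1 - d\<^sub>\<delta>(z\<^sub>i, y) / \<rho>\<^sub>i) w\<^sub>i\<close>. As the supports are disjoint, a difference of two of
  its values is a sum of at most two differences of values of single tents.\<close>

lemma tents:
  fixes z :: "nat \<Rightarrow> 'a::metric_space" and w :: "nat \<Rightarrow> 'b::real_normed_vector"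
  assumes "0 < \<delta>" and disj: "disjoint_chain_balls \<delta> z \<rho> I"
    and adm: "admissible_heights (\<lambda>i. norm (w i)) \<rho> I"
  obtains g where "g \<in> unif_cont_maps" "\<And>i. i \<in> I \<Longrightarrow> g (z i) = w i"
    "\<And>y. (\<And>i. i \<in> I \<Longrightarrow> ereal (\<rho> i) \<le> chain_dist \<delta> (z i) y) \<Longrightarrow> g y = 0"
proof -
  define c where "c i = capped_chain_dist \<delta> (\<rho> i) (z i)" for i
  define h where "h i y = (1 - c i y / \<rho> i) *\<^sub>R w i" for i y
  define g where "g y = (if \<exists>i\<in>I. c i y < \<rho> i then h (SOME i. i \<in> I \<and> c i y < \<rho> i) y else 0)" for y
  have \<rho>: "0 < \<rho> i" if "i \<in> I" for i using disj that by (auto simp: disjoint_chain_balls_def)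
  have c_bounds: "0 \<le> c i y" "c i y \<le> \<rho> i" if "i \<in> I" for i y
    using capped_chain_dist_bounds[of "\<rho> i" \<delta> "z i" y] \<rho>[OF that] by (auto simp: c_def)
  have c_less: "c i y < \<rho> i \<longleftrightarrow> chain_dist \<delta> (z i) y < ereal (\<rho> i)" if "i \<in> I" for i y
  proof -
    have "c i y < \<rho> i \<longleftrightarrow> ereal (c i y) < ereal (\<rho> i)" by simp
    also have "\<dots> \<longleftrightarrow> chain_dist \<delta> (z i) y < ereal (\<rho> i)"
      unfolding c_def using ereal_capped_chain_dist[of "\<rho> i" \<delta> "z i" y] \<rho>[OF that]
      by (simp add: min_less_iff_disj)
    finally show ?thesis .
  qed
  have unique: "i = j" if "i \<in> I" "j \<in> I" "c i y < \<rho> i" "c j y < \<rho> j" for i j y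
    using chain_balls_disjoint[OF disj that(1,2)] that(3,4) c_less[OF that(1)] c_less[OF that(2)] by blast
  have g_in: "g y = h i y" if "i \<in> I" "c i y < \<rho> i" for i y
  proof -
    have "(SOME i. i \<in> I \<and> c i y < \<rho> i) = i" using that unique by (intro some_equality) auto
    then show ?thesis using that by (auto simp: g_def)
  qed
  have h_out: "h i y = 0" if "i \<in> I" "\<not> c i y < \<rho> i" for i y
    using c_bounds(2)[of i y] \<rho>[of i] that by (simp add: h_def)
  have g_other: "h j y = 0" if "i \<in> I" "c i y < \<rho> i" "j \<in> I" "j \<noteq> i" for i j y
    using that unique h_out by blast
  have g_zero: "g y = 0" if "\<And>i. i \<in> I \<Longrightarrow> \<not> c i y < \<rho> i" for y using that by (auto simp: g_def)
  have bound: "norm (h i y - h i y') \<le> max \<epsilon> (C * dist y y')"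
    if "i \<in> I" "dist y y' \<le> \<delta>" "0 \<le> C" "norm (w i) \<le> max \<epsilon> (C * \<rho> i)" for i y y' \<epsilon> C
  proof -
    have "h i y - h i y' = ((c i y' - c i y) / \<rho> i) *\<^sub>R w i"
      by (simp add: h_def algebra_simps diff_divide_distrib)
    then have n: "norm (h i y - h i y') = \<bar>c i y' - c i y\<bar> / \<rho> i * norm (w i)"
      using \<rho>[OF that(1)] by simp
    have "\<bar>c i y' - c i y\<bar> \<le> dist y y'"
      unfolding c_def using capped_chain_dist_lipschitz[of "\<rho> i" y' y \<delta>] \<rho>[OF that(1)] that(2)
      by (simp add: dist_commute)
    then have 1: "\<bar>c i y' - c i y\<bar> / \<rho> i \<le> dist y y' / \<rho> i"
      using \<rho>[OF that(1)] by (simp add: divide_right_mono)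
    have 2: "\<bar>c i y' - c i y\<bar> / \<rho> i \<le> 1"
      using c_bounds[OF that(1), of y] c_bounds[OF that(1), of y'] \<rho>[OF that(1)] by (simp add: abs_le_iff)
    show ?thesis
    proof (cases "norm (w i) \<le> \<epsilon>")
      case True
      have "norm (h i y - h i y') \<le> 1 * norm (w i)"
        unfolding n by (rule mult_right_mono[OF 2]) simp
      then show ?thesis using True by auto
    next
      case False
      then have w: "norm (w i) \<le> C * \<rho> i" using that(4) by auto
      have "norm (h i y - h i y') \<le> dist y y' / \<rho> i * (C * \<rho> i)"
        unfolding n by (rule mult_mono[OF 1 w]) (use \<rho>[OF that(1)] in auto)
      then show ?thesis using \<rho>[OF that(1)] by (simp add: mult.commute)
    qed
  qed
  have "g \<in> unif_cont_maps"
  proof (rule unif_cont_mapsI)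
    fix \<epsilon> :: real assume "0 < \<epsilon>"
    then obtain C where C: "0 \<le> C" "\<And>i. i \<in> I \<Longrightarrow> norm (w i) \<le> max (\<epsilon>/3) (C * \<rho> i)"
      using adm unfolding admissible_heights_def by (metis divide_pos_pos zero_less_numeral)
    define \<eta> where "\<eta> = min \<delta> (\<epsilon> / (3 * (C + 1)))"
    have "0 < \<eta>" using \<open>0 < \<delta>\<close> \<open>0 < \<epsilon>\<close> C(1) by (simp add: \<eta>_def)
    moreover have "norm (g y - g y') < \<epsilon>" if "dist y y' < \<eta>" for y y'
    proof -
      have "dist y y' < \<epsilon> / (3 * (C + 1))" using that by (simp add: \<eta>_def)
      then have "3 * (C + 1) * dist y y' < \<epsilon>" using C(1) by (simp add: field_simps)
      then have "C * dist y y' \<le> \<epsilon>/3" using zero_le_dist[of y y'] by (simp add: algebra_simps del: zero_le_dist)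
      then have small: "norm (h i y - h i y') \<le> \<epsilon>/3" if "i \<in> I" for i
        using bound[OF that, of y y' C "\<epsilon>/3"] C \<open>dist y y' < \<eta>\<close> that by (simp add: \<eta>_def)
      consider (both) i where "i \<in> I" "g y = h i y" "g y' = h i y'"
        | (differ) i j where "i \<in> I" "j \<in> I" "g y = h i y" "g y' = h j y'" "h i y' = 0" "h j y = 0"
        | (left) i where "i \<in> I" "g y = h i y" "g y' = 0" "h i y' = 0"
        | (right) j where "j \<in> I" "g y' = h j y'" "g y = 0" "h j y = 0"
        | (none) "g y = 0" "g y' = 0"
        using g_in g_other g_zero h_out by metis
      then show ?thesis
      proof cases
        case both
        then show ?thesis using small[of i] \<open>0 < \<epsilon>\<close> by simp
      next
        case differ
        have "norm (g y) \<le> \<epsilon>/3" "norm (g y') \<le> \<epsilon>/3"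
          using differ small[of i] small[of j] by auto
        then show ?thesis using norm_triangle_ineq4[of "g y" "g y'"] \<open>0 < \<epsilon>\<close> by simp
      next
        case left
        then show ?thesis using small[of i] \<open>0 < \<epsilon>\<close> by simp
      next
        case right
        then show ?thesis using small[of j] \<open>0 < \<epsilon>\<close> by simp
      qed (use \<open>0 < \<epsilon>\<close> in simp)
    qed
    ultimately show "\<exists>\<eta>>0. \<forall>y y'. dist y y' < \<eta> \<longrightarrow> norm (g y - g y') < \<epsilon>" by blast
  qed
  moreover have "g (z i) = w i" if "i \<in> I" for i
  proof -
    have "c i (z i) = 0" using \<rho>[OF that] by (simp add: c_def capped_chain_dist_def min_def)
    then show ?thesis using g_in[of i "z i"] that \<rho>[OF that] by (simp add: h_def)
  qed
  moreover have "g y = 0" if "\<And>i. i \<in> I \<Longrightarrow> ereal (\<rho> i) \<le> chain_dist \<delta> (z i) y" for y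
    using g_zero c_less that by (meson not_less)
  ultimately show thesis by (rule that)
qed

lemma tents_dist:
  fixes z :: "nat \<Rightarrow> 'a::metric_space" and w :: "nat \<Rightarrow> 'b::real_normed_vector"
  assumes "\<And>i. i \<in> I \<Longrightarrow> 0 < \<rho> i"
    "\<And>i j. i \<in> I \<Longrightarrow> j \<in> I \<Longrightarrow> i < j \<Longrightarrow> \<rho> i + \<rho> j \<le> dist (z i) (z j)"
    "admissible_heights (\<lambda>i. norm (w i)) \<rho> I"
  obtains g where "g \<in> unif_cont_maps" "\<And>i. i \<in> I \<Longrightarrow> g (z i) = w i"
    "\<And>y. (\<And>i. i \<in> I \<Longrightarrow> \<rho> i \<le> dist (z i) y) \<Longrightarrow> g y = 0"
proof -
  from assms have "disjoint_chain_balls 1 z \<rho> I" by (intro disjoint_chain_balls_if_dist)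
  from tents[OF zero_less_one this assms(3)] obtain g where
    "g \<in> unif_cont_maps" "\<And>i. i \<in> I \<Longrightarrow> g (z i) = w i"
    "\<And>y. (\<And>i. i \<in> I \<Longrightarrow> ereal (\<rho> i) \<le> chain_dist 1 (z i) y) \<Longrightarrow> g y = 0" by blast
  moreover have "ereal (\<rho> i) \<le> chain_dist 1 (z i) y" if "\<rho> i \<le> dist (z i) y" for i y
    using that dist_le_chain_dist order_trans ereal_less_eq(3) by blast
  ultimately show thesis by (intro that[of g]) auto
qed

lemma tent:
  fixes p :: "'a::metric_space" and w :: "'b::real_normed_vector"
  assumes "0 < r"
  obtains g where "g \<in> unif_cont_maps" "g p = w" "\<And>y. r \<le> dist p y \<Longrightarrow> g y = 0"
proof -
  have "admissible_heights (\<lambda>i. norm w) (\<lambda>_. r) {0}"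
    by (rule admissible_heights_linear[of _ _ "norm w / r"]) (use assms in auto)
  from tents_dist[of "{0}" "\<lambda>_. r" "\<lambda>_. p" "\<lambda>_. w", OF _ _ this] assms
  obtain g where "g \<in> unif_cont_maps" "g p = w" "\<And>y. r \<le> dist p y \<Longrightarrow> g y = 0"
    by (auto simp: disjoint_iff)
  then show thesis by (rule that)
qed

text \<open>Two cases, by \<open>infinite_homogeneous_subset\<close>. If the values \<open>e n\<close> are bounded, the separation constant
  serves as radius. If their norms grow geometrically, then \<open>e n - e m\<close> is comparable to the larger of
  both, so that the assumed bound puts \<open>z n\<close> and \<open>z m\<close> at a chain distance that is comparable to it.
  The summand \<open>1\<close> leaves room for heights slightly larger than the norms.\<close>

lemma chain_ball_radii:
  fixes z :: "nat \<Rightarrow> 'a::metric_space" and e :: "nat \<Rightarrow> 'b::real_normed_vector"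
  assumes I: "infinite I" and s: "0 < s" "separated_on s z I" and "0 \<le> C"
    and le: "\<And>m n. m \<in> I \<Longrightarrow> n \<in> I \<Longrightarrow> ereal (norm (e n - e m)) \<le> ereal C * chain_dist \<delta> (z n) (z m)"
  obtains J \<rho> K where "J \<subseteq> I" "infinite J" "disjoint_chain_balls \<delta> z \<rho> J"
    "\<And>n. n \<in> J \<Longrightarrow> norm (e n) + 1 \<le> K * \<rho> n"
  using I
proof (cases rule: infinite_homogeneous_subset[where P = "\<lambda>m n. 2 * norm (e m) + 1 \<le> norm (e n)"])
  case (all J)
  define D where "D = C + 1"
  define \<rho> where "\<rho> n = (norm (e n) + 1) / (4 * D)" for n
  have D: "0 < D" "C \<le> D" using \<open>0 \<le> C\<close> by (auto simp: D_def)
  have "disjoint_chain_balls \<delta> z \<rho> J"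
    unfolding disjoint_chain_balls_def
  proof (intro conjI ballI impI)
    show "0 < \<rho> n" for n using D(1) by (simp add: \<rho>_def add_nonneg_pos)
    have less: "ereal (\<rho> m + \<rho> n) \<le> chain_dist \<delta> (z n) (z m)" if "m \<in> J" "n \<in> J" "m < n" for m n
    proof -
      have "2 * norm (e m) + 1 \<le> norm (e n)" using all(3) that by blast
      moreover have "norm (e n) - norm (e m) \<le> norm (e n - e m)" by (rule norm_triangle_ineq2)
      ultimately have "norm (e m) + 1 + (norm (e n) + 1) \<le> 4 * norm (e n - e m)"
        using norm_ge_zero[of "e m"] by linarith
      then have "\<rho> m + \<rho> n \<le> norm (e n - e m) / D"
        using D(1) divide_right_mono[of _ "4 * norm (e n - e m)" "4 * D"]
        by (simp add: \<rho>_def add_divide_distrib[symmetric])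
      moreover have "ereal (norm (e n - e m)) \<le> ereal D * chain_dist \<delta> (z n) (z m)"
        using le[of m n] that all(1) D chain_dist_nonneg[of \<delta> "z n" "z m"]
        by (meson ereal_less_eq(3) ereal_mult_right_mono order_trans subsetD)
      then have "ereal (norm (e n - e m) / D) \<le> chain_dist \<delta> (z n) (z m)"
        using D(1) by (cases "chain_dist \<delta> (z n) (z m)") (auto simp: field_simps)
      ultimately show ?thesis using order_trans ereal_less_eq(3) by blast
    qed
    fix i j assume "i \<in> J" "j \<in> J" "i \<noteq> j"
    then show "ereal (\<rho> i + \<rho> j) \<le> chain_dist \<delta> (z i) (z j)"
      using less[of i j] less[of j i] chain_dist_commute[of \<delta> "z i" "z j"]
      by (cases "i < j") (auto simp: add.commute)
  qed
  then show thesis using all D(1) by (intro that[of J \<rho> "4 * D"]) (auto simp: \<rho>_def)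
next
  case (none J)
  obtain m where m: "m \<in> J" "\<And>n. n \<in> J \<Longrightarrow> m \<le> n"
    using none(2) Least_le[of "\<lambda>n. n \<in> J"] LeastI_ex[of "\<lambda>n. n \<in> J"]
    by (metis finite.emptyI ex_in_conv)
  define M where "M = 2 * norm (e m) + 1"
  have M: "norm (e n) \<le> M" if "n \<in> J" for n
    using none(3)[OF m(1) that] m(2)[OF that] norm_ge_zero[of "e m"] by (cases "n = m") (auto simp: M_def)
  have "disjoint_chain_balls \<delta> z (\<lambda>_. s/2) J"
  proof (rule disjoint_chain_balls_if_dist)
    fix i j assume "i \<in> J" "j \<in> J" "i < j"
    then have "s \<le> dist (z i) (z j)" using s(2) none(1) by (force simp: separated_on_def)
    then show "s/2 + s/2 \<le> dist (z i) (z j)" by simp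
  qed (use s(1) in simp)
  then show thesis
    using none M s(1) by (intro that[of J "\<lambda>_. s/2" "2 * (M + 1) / s"]) auto
qed

text \<open>At distances at least \<open>s\<close>, the additive constant of \<open>unif_cont_norm_le_chain_dist\<close> can be absorbed
  into the Lipschitz constant, since the chain distance is at least \<open>s\<close> as well. So uniformly continuous
  functions turn separated sequences into \<open>u\<close>-sequences.\<close>

lemma unif_cont_u_sequence:
  fixes f :: "'a::metric_space \<Rightarrow> 'b::real_normed_vector"
  assumes f: "f \<in> unif_cont_maps" and s: "0 < s"
  obtains \<delta> C where "0 < \<delta>" "0 < C"
    "\<And>a b. a = b \<or> s \<le> dist a b \<Longrightarrow> ereal (norm (f a - f b)) \<le> ereal C * chain_dist \<delta> a b"
proof -
  obtain \<delta> C where C: "0 < \<delta>" "0 < C"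
    "\<And>a b. ereal (norm (f a - f b)) \<le> 1 + ereal C * chain_dist \<delta> a b"
    using unif_cont_norm_le_chain_dist[OF f] by blast
  have "ereal (norm (f a - f b)) \<le> ereal (C + 1/s) * chain_dist \<delta> a b" if "a = b \<or> s \<le> dist a b" for a b
  proof (cases "a = b")
    case False
    then have "ereal s \<le> chain_dist \<delta> a b"
      using that dist_le_chain_dist order_trans ereal_less_eq(3) by blast
    show ?thesis
    proof (cases "chain_dist \<delta> a b")
      case (real r)
      have "norm (f a - f b) \<le> 1 + C * r" using C(3)[of a b] real by (simp add: one_ereal_def)
      moreover have "1 \<le> r / s" using \<open>ereal s \<le> chain_dist \<delta> a b\<close> real s by simp
      ultimately show ?thesis using real by (simp add: algebra_simps)
    next
      case PInf
      moreover have "0 < C + 1/s" using C(2) s by (simp add: add_pos_pos)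
      ultimately show ?thesis by simp
    next
      case MInf
      then show ?thesis using chain_dist_nonneg[of \<delta> a b] by simp
    qed
  qed simp
  then show thesis using C s by (intro that[of \<delta> "C + 1/s"]) (auto simp: add_pos_pos)
qed

text \<open>The radial retraction onto the ball of radius \<open>max 0 a\<close>. Clipping replaces multiplication by a
  cut-off function, which does not preserve uniform continuity of unbounded functions.\<close>

definition clip :: "real \<Rightarrow> 'b::real_normed_vector \<Rightarrow> 'b" where
  "clip a v = (min (norm v) (max 0 a) / norm v) *\<^sub>R v"

lemma norm_clip: "norm (clip a v) = min (norm v) (max 0 a)"
  by (auto simp: clip_def)

lemma clip_eq_self: "norm v \<le> a \<Longrightarrow> clip a v = v"
  using norm_ge_zero[of v] by (cases "v = 0") (auto simp: clip_def min_def max_def simp del: norm_ge_zero)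

lemma clip_eq_0: "a \<le> 0 \<Longrightarrow> clip a v = 0"
  by (simp add: clip_def min_def max_def)

text \<open>Lengths and directions are compared separately; the difference of the unit vectors of \<open>v\<close> and \<open>w\<close> is
  at most \<open>2 * norm (v - w) / norm w\<close>.\<close>

lemma norm_clip_diff: "norm (clip a v - clip b w) \<le> \<bar>a - b\<bar> + 3 * norm (v - w)"
proof (cases "v = 0 \<or> w = 0")
  case True
  then show ?thesis
    using norm_clip[of a v] norm_clip[of b w] norm_ge_zero[of v] norm_ge_zero[of w]
    by (auto simp: clip_def[of _ 0] simp del: norm_ge_zero)
next
  case False
  define \<mu> \<nu> where "\<mu> = min (norm v) (max 0 a)" and "\<nu> = min (norm w) (max 0 b)"
  have "clip a v - clip b w = ((\<mu> - \<nu>) / norm v) *\<^sub>R v + (\<nu> / norm w) *\<^sub>R ((norm w / norm v) *\<^sub>R v - w)"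
    using False by (simp add: clip_def \<mu>_def[symmetric] \<nu>_def[symmetric] algebra_simps diff_divide_distrib)
  then have "norm (clip a v - clip b w) \<le> norm (((\<mu> - \<nu>) / norm v) *\<^sub>R v)
      + norm ((\<nu> / norm w) *\<^sub>R ((norm w / norm v) *\<^sub>R v - w))"
    by (metis norm_triangle_ineq)
  also have "norm (((\<mu> - \<nu>) / norm v) *\<^sub>R v) = \<bar>\<mu> - \<nu>\<bar>" using False by simp
  also have "norm ((\<nu> / norm w) *\<^sub>R ((norm w / norm v) *\<^sub>R v - w)) \<le> 1 * (2 * norm (v - w))"
    unfolding norm_scaleR
  proof (rule mult_mono)
    show "\<bar>\<nu> / norm w\<bar> \<le> 1" using False by (simp add: \<nu>_def)
    have "(norm w / norm v) *\<^sub>R v - w = (v - w) + ((norm w - norm v) / norm v) *\<^sub>R v"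
      using False by (simp add: algebra_simps diff_divide_distrib)
    then have "norm ((norm w / norm v) *\<^sub>R v - w) \<le> norm (v - w) + norm (((norm w - norm v) / norm v) *\<^sub>R v)"
      by (metis norm_triangle_ineq)
    also have "norm (((norm w - norm v) / norm v) *\<^sub>R v) = \<bar>norm w - norm v\<bar>" using False by simp
    also have "\<dots> \<le> norm (v - w)" by (metis norm_triangle_ineq3 norm_minus_commute)
    finally show "norm ((norm w / norm v) *\<^sub>R v - w) \<le> 2 * norm (v - w)" by simp
  qed auto
  also have "\<bar>\<mu> - \<nu>\<bar> \<le> \<bar>a - b\<bar> + norm (v - w)"
    using norm_triangle_ineq3[of v w] by (auto simp: \<mu>_def \<nu>_def)
  finally show ?thesis by simp
qed

lemma unif_cont_clip:
  assumes "a \<in> unif_cont_maps" "G \<in> unif_cont_maps"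
  shows "(\<lambda>y. clip (a y) (G y)) \<in> unif_cont_maps"
proof (rule unif_cont_mapsI)
  fix \<epsilon> :: real assume "0 < \<epsilon>"
  then have e: "0 < \<epsilon>/4" by simp
  obtain \<delta> where \<delta>: "0 < \<delta>" "\<And>x y. dist x y < \<delta> \<Longrightarrow> norm (a x - a y) < \<epsilon>/4"
    using unif_cont_mapsD[OF assms(1) e] by blast
  obtain \<eta> where \<eta>: "0 < \<eta>" "\<And>x y. dist x y < \<eta> \<Longrightarrow> norm (G x - G y) < \<epsilon>/4"
    using unif_cont_mapsD[OF assms(2) e] by blast
  have "norm (clip (a x) (G x) - clip (a y) (G y)) < \<epsilon>" if "dist x y < min \<delta> \<eta>" for x y
    using norm_clip_diff[of "a x" "G x" "a y" "G y"] \<delta>(2)[of x y] \<eta>(2)[of x y] that by simp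
  then show "\<exists>\<delta>>0. \<forall>x y. dist x y < \<delta> \<longrightarrow> norm (clip (a x) (G x) - clip (a y) (G y)) < \<epsilon>"
    using \<delta>(1) \<eta>(1) by (intro exI[of _ "min \<delta> \<eta>"]) auto
qed

lemma eventually_nhds_less:
  fixes f g :: "'a::metric_space \<Rightarrow> real"
  assumes "isCont f x" "isCont g x" "f x < g x"
  shows "\<forall>\<^sub>F y in nhds x. f y < g y"
proof -
  have "\<forall>\<^sub>F y in nhds x. 0 < g y - f y"
    using assms by (intro order_tendstoD(1)[of _ "g x - f x"] tendsto_diff) (auto simp: isCont_def tendsto_at_iff_tendsto_nhds)
  then show ?thesis by simp
qed

text \<open>\<open>G\<close> is clipped at a sum of tents that exceeds its norm at the points with index in \<open>K\<close> and is
  negative at the other ones. By continuity both inequalities persist nearby, so that \<open>H\<close> is equal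
  to \<open>G\<close>, respectively to \<open>0\<close>, on whole neighbourhoods.\<close>

lemma alternate:
  fixes G :: "'a::metric_space \<Rightarrow> 'b::real_normed_vector"
  assumes "G \<in> unif_cont_maps" "0 < \<delta>" "disjoint_chain_balls \<delta> z \<rho> I"
    and b: "\<And>i. i \<in> I \<Longrightarrow> 0 < b i" "\<And>i. i \<in> I \<Longrightarrow> norm (G (z i)) < b i"
    and adm: "admissible_heights b \<rho> I"
  obtains H where "H \<in> unif_cont_maps"
    "\<And>i. i \<in> I \<inter> K \<Longrightarrow> \<forall>\<^sub>F y in nhds (z i). H y = G y"
    "\<And>i. i \<in> I - K \<Longrightarrow> \<forall>\<^sub>F y in nhds (z i). H y = 0"
proof -
  let ?w = "\<lambda>i. if i \<in> K then b i else - b i"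
  have "norm (?w i) = b i" if "i \<in> I" for i using b(1)[OF that] by auto
  then have "admissible_heights (\<lambda>i. norm (?w i)) \<rho> I"
    using adm unfolding admissible_heights_def by auto
  from tents[OF assms(2,3) this] obtain a where a: "a \<in> unif_cont_maps" "\<And>i. i \<in> I \<Longrightarrow> a (z i) = ?w i"
    by metis
  have "\<forall>\<^sub>F y in nhds (z i). clip (a y) (G y) = G y" if "i \<in> I \<inter> K" for i
  proof -
    have "\<forall>\<^sub>F y in nhds (z i). norm (G y) < a y"
      using a b(2)[of i] assms(1) that by (intro eventually_nhds_less isCont_norm unif_cont_isCont) auto
    then show ?thesis by (rule eventually_mono) (simp add: clip_eq_self)
  qed
  moreover have "\<forall>\<^sub>F y in nhds (z i). clip (a y) (G y) = 0" if "i \<in> I - K" for i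
  proof -
    have "\<forall>\<^sub>F y in nhds (z i). a y < 0"
      using a b(1)[of i] that by (intro eventually_nhds_less unif_cont_isCont unif_cont_const) auto
    then show ?thesis by (rule eventually_mono) (simp add: clip_eq_0)
  qed
  ultimately show thesis using that unif_cont_clip[OF a(1) assms(1)] by blast
qed

text \<open>Along a subsequence, the distances to \<open>l\<close> decrease at least by the factor \<open>3\<close>. The conclusion is that
  the balls around \<open>x n\<close> of half these radii are disjoint.\<close>

lemma sparse_subset:
  fixes x :: "nat \<Rightarrow> 'a::metric_space"
  assumes I: "infinite I" and lim: "(x \<longlongrightarrow> l) (along I)" and ne: "\<And>n. n \<in> I \<Longrightarrow> x n \<noteq> l"
  obtains J where "J \<subseteq> I" "infinite J"
    "\<And>m n. m \<in> J \<Longrightarrow> n \<in> J \<Longrightarrow> m < n \<Longrightarrow> dist (x m) l / 2 + dist (x n) l / 2 \<le> dist (x m) (x n)"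
  using I
proof (cases rule: infinite_homogeneous_subset[where P = "\<lambda>m n. 3 * dist (x n) l \<le> dist (x m) l"])
  case (all J)
  have "dist (x m) l / 2 + dist (x n) l / 2 \<le> dist (x m) (x n)" if "m \<in> J" "n \<in> J" "m < n" for m n
    using all(3)[OF that] dist_triangle[of "x m" l "x n"] by linarith
  then show thesis using that all by blast
next
  case (none J)
  obtain m where m: "m \<in> J" using none(2) by fastforce
  have "\<forall>\<^sub>F n in along J. dist (x n) l < dist (x m) l / 3"
    by (rule tendstoD[OF tendsto_along_mono[OF lim none(1)]]) (use ne[of m] m none(1) in auto)
  then have "infinite {n\<in>J. dist (x n) l < dist (x m) l / 3}"
    using none(2) by (rule eventually_along_infinite)
  then obtain n where "n > m" "n \<in> J" "dist (x n) l < dist (x m) l / 3"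
    unfolding infinite_nat_iff_unbounded by blast
  then show thesis using none(3)[OF m, of n] by simp
qed

text \<open>Tents over tiny balls are uniformly continuous together as long as their heights tend to \<open>0\<close>. So the
  values at \<open>x' n\<close> can be changed by null sequences independently of the values at \<open>x n\<close>, however close
  \<open>x' n\<close> is to \<open>x n\<close>.\<close>

lemma perturb_near_separated:
  fixes x x' :: "nat \<Rightarrow> 'a::metric_space" and w :: "nat \<Rightarrow> 'b::real_normed_vector"
  assumes I: "infinite I" and s: "0 < s" "separated_on s x I"
    and d: "((\<lambda>n. dist (x n) (x' n)) \<longlongrightarrow> 0) (along I)" and ne: "\<And>n. n \<in> I \<Longrightarrow> x n \<noteq> x' n"
    and w: "((\<lambda>n. norm (w n)) \<longlongrightarrow> 0) (along I)"
  obtains J f where "J \<subseteq> I" "infinite J" "f \<in> unif_cont_maps"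
    "\<And>n. n \<in> J \<Longrightarrow> f (x' n) = w n" "\<And>n. n \<in> J \<Longrightarrow> f (x n) = 0"
proof -
  define J where "J = {n\<in>I. dist (x n) (x' n) < s/3}"
  have "J \<subseteq> I" by (auto simp: J_def)
  have "infinite J" unfolding J_def
    by (rule eventually_along_infinite[OF order_tendstoD(2)[OF d] I]) (use s(1) in simp)
  have near: "dist (x n) (x' n) < s/3" if "n \<in> J" for n using that by (simp add: J_def)
  have sep: "s \<le> dist (x m) (x n)" if "m \<in> J" "n \<in> J" "m \<noteq> n" for m n
    using s(2) that \<open>J \<subseteq> I\<close> unfolding separated_on_def by blast
  obtain f where f: "f \<in> unif_cont_maps" "\<And>n. n \<in> J \<Longrightarrow> f (x' n) = w n"
    "\<And>y. (\<And>n. n \<in> J \<Longrightarrow> dist (x n) (x' n) / 2 \<le> dist (x' n) y) \<Longrightarrow> f y = 0"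
  proof (rule tents_dist[of J "\<lambda>n. dist (x n) (x' n) / 2" x' w])
    show pos: "0 < dist (x n) (x' n) / 2" if "n \<in> J" for n using ne[of n] that \<open>J \<subseteq> I\<close> by auto
    show "admissible_heights (\<lambda>i. norm (w i)) (\<lambda>n. dist (x n) (x' n) / 2) J"
      using tendsto_along_mono[OF w \<open>J \<subseteq> I\<close>] pos by (rule admissible_heights_null)
    fix i j assume ij: "i \<in> J" "j \<in> J" "i < j"
    have "dist (x i) (x j) \<le> dist (x i) (x' i) + dist (x' i) (x' j) + dist (x j) (x' j)"
      using dist_triangle[of "x i" "x j" "x' i"] dist_triangle[of "x' i" "x j" "x' j"]
      by (simp add: dist_commute)
    then show "dist (x i) (x' i) / 2 + dist (x j) (x' j) / 2 \<le> dist (x' i) (x' j)"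
      using near[OF ij(1)] near[OF ij(2)] sep[OF ij(1,2)] ij(3) by simp
  qed blast
  have "f (x n) = 0" if n: "n \<in> J" for n
  proof (rule f(3))
    fix m assume m: "m \<in> J"
    show "dist (x m) (x' m) / 2 \<le> dist (x' m) (x n)"
    proof (cases "m = n")
      case False
      then show ?thesis
        using near[OF m] sep[OF m n] dist_triangle[of "x m" "x n" "x' m"] s(1) by simp
    qed (simp add: dist_commute)
  qed
  then show thesis using that \<open>J \<subseteq> I\<close> \<open>infinite J\<close> f by blast
qed

text \<open>A given point lies in at most one of the disjoint sets \<open>B n\<close>, so that no infinite set can be
  homogeneous for \<open>p m \<in> B n\<close>, be it for \<open>m < n\<close> or for \<open>n < m\<close>.\<close>

lemma avoid_subset:
  fixes B :: "nat \<Rightarrow> 'a set"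
  assumes I: "infinite I" and own: "\<And>n. n \<in> I \<Longrightarrow> p n \<notin> B n"
    and disj: "\<And>m n. m \<in> I \<Longrightarrow> n \<in> I \<Longrightarrow> m \<noteq> n \<Longrightarrow> B m \<inter> B n = {}"
  obtains J where "J \<subseteq> I" "infinite J" "\<And>m n. m \<in> J \<Longrightarrow> n \<in> J \<Longrightarrow> p m \<notin> B n"
proof -
  have three: "\<exists>a b c. a \<in> J \<and> b \<in> J \<and> c \<in> J \<and> a < b \<and> b < (c::nat)" if "infinite J" for J
    using that unfolding infinite_nat_iff_unbounded by metis
  obtain J where J: "J \<subseteq> I" "infinite J" "\<And>m n. m \<in> J \<Longrightarrow> n \<in> J \<Longrightarrow> m < n \<Longrightarrow> p m \<notin> B n"
    using I
  proof (cases rule: infinite_homogeneous_subset[where P = "\<lambda>m n. p m \<in> B n"])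
    case (all J)
    obtain a b c where "a \<in> J" "b \<in> J" "c \<in> J" "a < b" "b < c" using three[OF all(2)] by blast
    then show thesis using all(1) all(3)[of a b] all(3)[of a c] disj[of b c] by auto
  qed (use that in blast)
  obtain K where K: "K \<subseteq> J" "infinite K" "\<And>m n. m \<in> K \<Longrightarrow> n \<in> K \<Longrightarrow> m < n \<Longrightarrow> p n \<notin> B m"
    using J(2)
  proof (cases rule: infinite_homogeneous_subset[where P = "\<lambda>m n. p n \<in> B m"])
    case (all K)
    obtain a b c where "a \<in> K" "b \<in> K" "c \<in> K" "a < b" "b < c" using three[OF all(2)] by blast
    then show thesis using all(1) J(1) all(3)[of a c] all(3)[of b c] disj[of a b] by auto
  qed (use that in blast)
  have "p m \<notin> B n" if "m \<in> K" "n \<in> K" for m n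
    using own[of n] J(1) J(3)[of m n] K(1) K(3)[of n m] that by (cases m n rule: linorder_cases) auto
  then show thesis using that J K by blast
qed

section \<open>Linked sets of a biseparating map\<close>

abbreviation differ :: "('a \<Rightarrow> 'b) \<Rightarrow> ('a \<Rightarrow> 'b) \<Rightarrow> 'a set" where
  "differ f g \<equiv> {x. f x \<noteq> g x}"

lemma open_differ:
  fixes f g :: "'a::metric_space \<Rightarrow> 'b::real_normed_vector"
  assumes "f \<in> unif_cont_maps" "g \<in> unif_cont_maps"
  shows "open (differ f g)"
  using assms unfolding unif_cont_maps_def
  by (intro open_Collect_neq) (auto intro: uniformly_continuous_imp_continuous)

lemma bump:
  fixes h :: "'a::metric_space \<Rightarrow> 'b::real_normed_vector"
  assumes "\<exists>e::'b. e \<noteq> 0" "open U" "x \<in> U" "h \<in> unif_cont_maps"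
  obtains f where "f \<in> unif_cont_maps" "f x \<noteq> h x" "closure (differ f h) \<subseteq> U"
proof -
  obtain e :: 'b where "e \<noteq> 0" using assms(1) by blast
  obtain r where r: "0 < r" "cball x r \<subseteq> U" using assms(2,3) open_contains_cball by blast
  obtain g :: "'a \<Rightarrow> 'b" where g: "g \<in> unif_cont_maps" "g x = e" "\<And>y. r \<le> dist x y \<Longrightarrow> g y = 0"
    using tent[OF r(1)] by blast
  have "differ (\<lambda>y. h y + g y) h \<subseteq> cball x r" using g(3) by force
  then have "closure (differ (\<lambda>y. h y + g y) h) \<subseteq> U"
    using r(2) closure_minimal[OF _ closed_cball] by blast
  then show thesis
    using that[of "\<lambda>y. h y + g y"] unif_cont_add[OF assms(4) g(1)] g(2) \<open>e \<noteq> 0\<close> by simp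
qed

lemma ball_subset_ball: "dist a b + r \<le> s \<Longrightarrow> ball a r \<subseteq> ball b s"
proof
  fix z assume "dist a b + r \<le> s" "z \<in> ball a r"
  then show "z \<in> ball b s" using dist_triangle[of b z a] by (simp add: dist_commute)
qed

text \<open>A substitute for a correspondence between open sets. It is symmetric in \<open>T\<close> and its inverse and
  allows the base function \<open>h\<close> to be nonzero, as \<open>T\<close> need not be linear.\<close>

definition linked ::
  "(('x::metric_space \<Rightarrow> 'e::real_normed_vector) \<Rightarrow> ('y::metric_space \<Rightarrow> 'f::real_normed_vector)) \<Rightarrow>
    'x set \<Rightarrow> 'y set \<Rightarrow> bool" where
  "linked T U V \<longleftrightarrow> (\<exists>f\<in>unif_cont_maps. \<exists>h\<in>unif_cont_maps.
     f \<noteq> h \<and> differ f h \<subseteq> U \<and> differ (T f) (T h) \<subseteq> V)"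

lemma linked_mono: "linked T U V \<Longrightarrow> U \<subseteq> U' \<Longrightarrow> V \<subseteq> V' \<Longrightarrow> linked T U' V'"
  unfolding linked_def by (meson order_trans)

definition corresponds ::
  "(('x::metric_space \<Rightarrow> 'e::real_normed_vector) \<Rightarrow> ('y::metric_space \<Rightarrow> 'f::real_normed_vector)) \<Rightarrow>
    'x \<Rightarrow> 'y \<Rightarrow> bool" where
  "corresponds T x y \<longleftrightarrow> (\<forall>r>0. linked T (ball x r) (ball y r))"

definition support_map ::
  "(('x::metric_space \<Rightarrow> 'e::real_normed_vector) \<Rightarrow> ('y::metric_space \<Rightarrow> 'f::real_normed_vector)) \<Rightarrow>
    'x \<Rightarrow> 'y" where
  "support_map T x = (THE y. corresponds T x y)"

text \<open>Naming the inverse \<open>S\<close> makes the assumptions symmetric, so that every result below also holds with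
  the roles of \<open>T\<close> and \<open>S\<close> exchanged. The relation \<open>f \<bottom>\<^sub>h g\<close> is spelled out pointwise: \<open>f\<close> or \<open>g\<close> is equal
  to \<open>h\<close> at every point.\<close>

locale biseparating_pair =
  fixes T :: "('x::complete_space \<Rightarrow> 'e::banach) \<Rightarrow> ('y::complete_space \<Rightarrow> 'f::banach)"
    and S :: "('y \<Rightarrow> 'f) \<Rightarrow> ('x \<Rightarrow> 'e)"
  assumes T_in: "\<And>f. f \<in> unif_cont_maps \<Longrightarrow> T f \<in> unif_cont_maps"
    and S_in: "\<And>g. g \<in> unif_cont_maps \<Longrightarrow> S g \<in> unif_cont_maps"
    and ST: "\<And>f. f \<in> unif_cont_maps \<Longrightarrow> S (T f) = f"
    and TS: "\<And>g. g \<in> unif_cont_maps \<Longrightarrow> T (S g) = g"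
    and perp: "\<And>f g h. f \<in> unif_cont_maps \<Longrightarrow> g \<in> unif_cont_maps \<Longrightarrow> h \<in> unif_cont_maps \<Longrightarrow>
      (\<forall>x. f x = h x \<or> g x = h x) \<longleftrightarrow> (\<forall>y. T f y = T h y \<or> T g y = T h y)"
    and nontrivial_E: "\<exists>e::'e. e \<noteq> 0"
    and nontrivial_F: "\<exists>e::'f. e \<noteq> 0"
begin

lemma dual: "biseparating_pair S T"
proof (rule biseparating_pair.intro)
  fix f g h :: "'y \<Rightarrow> 'f"
  assume *: "f \<in> unif_cont_maps" "g \<in> unif_cont_maps" "h \<in> unif_cont_maps"
  show "(\<forall>x. f x = h x \<or> g x = h x) \<longleftrightarrow> (\<forall>y. S f y = S h y \<or> S g y = S h y)"
    using perp[OF S_in[OF *(1)] S_in[OF *(2)] S_in[OF *(3)]] * by (simp add: TS)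
qed (fact T_in S_in ST TS nontrivial_E nontrivial_F)+

lemma T_eq_iff: "f \<in> unif_cont_maps \<Longrightarrow> g \<in> unif_cont_maps \<Longrightarrow> T f = T g \<longleftrightarrow> f = g"
  by (metis ST)

lemma linked_dual: "linked S V U \<longleftrightarrow> linked T U V"
proof
  assume "linked S V U"
  then obtain f h where fh: "f \<in> unif_cont_maps" "h \<in> unif_cont_maps" "f \<noteq> h" "differ f h \<subseteq> V"
    "differ (S f) (S h) \<subseteq> U" unfolding linked_def by blast
  moreover have "S f \<noteq> S h" using fh(1-3) TS by metis
  ultimately show "linked T U V"
    unfolding linked_def by (intro bexI[of _ "S f"] bexI[of _ "S h"]) (simp_all add: TS S_in)
next
  assume "linked T U V"
  then obtain f h where fh: "f \<in> unif_cont_maps" "h \<in> unif_cont_maps" "f \<noteq> h" "differ f h \<subseteq> U"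
    "differ (T f) (T h) \<subseteq> V" unfolding linked_def by blast
  moreover have "T f \<noteq> T h" using fh(1-3) ST by metis
  ultimately show "linked S V U"
    unfolding linked_def by (intro bexI[of _ "T f"] bexI[of _ "T h"]) (simp_all add: ST T_in)
qed

lemma corresponds_dual: "corresponds S y x \<longleftrightarrow> corresponds T x y"
  by (simp add: corresponds_def linked_dual)

text \<open>Inclusion of these sets, up to closure, can be expressed by the relation \<open>\<bottom>\<^sub>h\<close>: every function that is
  disjoint from \<open>g\<close> relative to \<open>h\<close> is disjoint from \<open>f\<close>.\<close>

lemma differ_subset_closure:
  assumes fgh: "f \<in> unif_cont_maps" "g \<in> unif_cont_maps" "h \<in> unif_cont_maps"
    and sub: "differ (T f) (T h) \<subseteq> differ (T g) (T h)"
  shows "differ f h \<subseteq> closure (differ g h)"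
proof (rule subsetI, rule ccontr)
  fix x assume x: "x \<in> differ f h" "x \<notin> closure (differ g h)"
  obtain j where j: "j \<in> unif_cont_maps" "j x \<noteq> h x" "closure (differ j h) \<subseteq> - closure (differ g h)"
    using bump[OF nontrivial_E, of "- closure (differ g h)" x h] x(2) fgh by auto
  have "\<forall>z. j z = h z \<or> g z = h z"
    using j(3) closure_subset[of "differ j h"] closure_subset[of "differ g h"] by blast
  then have "\<forall>y. T j y = T h y \<or> T f y = T h y" using perp[OF j(1) fgh(2,3)] sub by blast
  then have "\<forall>z. j z = h z \<or> f z = h z" using perp[OF j(1) fgh(1,3)] by blast
  then show False using x(1) j(2) by auto
qed

text \<open>The functions \<open>h\<close>, \<open>j\<close>, \<open>j + m - h\<close>, \<open>m\<close> are the vertices of a parallelogram, in which at every point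
  one pair of opposite sides has length \<open>0\<close>. This is expressed by four relations of the form \<open>f \<bottom>\<^sub>h g\<close>, one
  for each vertex, and therefore passes to the images under \<open>T\<close>, even though \<open>T\<close> is not additive.\<close>

lemma parallelogram:
  assumes "j \<in> unif_cont_maps" "m \<in> unif_cont_maps" "h \<in> unif_cont_maps"
    and disj: "\<forall>x. j x = h x \<or> m x = h x"
  shows "(\<lambda>x. j x + m x - h x) \<in> unif_cont_maps"
    and "differ (T (\<lambda>x. j x + m x - h x)) (T m) = differ (T j) (T h)"
proof -
  let ?k = "\<lambda>x. j x + m x - h x"
  show k: "?k \<in> unif_cont_maps" using assms by (intro unif_cont_add unif_cont_diff)
  have "\<forall>y. T j y = T h y \<or> T m y = T h y" using perp assms by blast
  moreover have "\<forall>y. T j y = T ?k y \<or> T m y = T ?k y"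
  proof (rule iffD1[OF perp[OF assms(1,2) k]], rule allI)
    fix x show "j x = ?k x \<or> m x = ?k x" using disj[rule_format, of x] by auto
  qed
  moreover have "\<forall>y. T ?k y = T j y \<or> T h y = T j y"
  proof (rule iffD1[OF perp[OF k assms(3,1)]], rule allI)
    fix x show "?k x = j x \<or> h x = j x" using disj[rule_format, of x] by auto
  qed
  moreover have "\<forall>y. T h y = T m y \<or> T ?k y = T m y"
  proof (rule iffD1[OF perp[OF assms(3) k assms(2)]], rule allI)
    fix x show "h x = m x \<or> ?k x = m x" using disj[rule_format, of x] by auto
  qed
  ultimately have "T ?k y \<noteq> T m y \<longleftrightarrow> T j y \<noteq> T h y" for y by metis
  then show "differ (T ?k) (T m) = differ (T j) (T h)" by auto
qed

text \<open>The base function is changed locally. A function \<open>m\<close> interpolates between \<open>h\<close> near a point \<open>x\<close> and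
  \<open>q\<close> away from \<open>x\<close>. By \<open>parallelogram\<close>, a difference over \<open>h\<close> that is concentrated near \<open>x\<close> can be moved
  to \<open>m\<close>. A difference over \<open>q\<close> can be moved to \<open>m\<close> if it vanishes near \<open>x\<close>; so the differences over \<open>q\<close>
  whose images lie in the set obtained from the first step cannot all vanish near \<open>x\<close>.\<close>

lemma linked_base_change:
  assumes "linked T U V" and q: "q \<in> unif_cont_maps"
  obtains j where "j \<in> unif_cont_maps" "j \<noteq> q" "differ j q \<subseteq> U" "differ (T j) (T q) \<subseteq> V"
proof -
  obtain f h where f: "f \<in> unif_cont_maps" and h: "h \<in> unif_cont_maps" and "f \<noteq> h"
    and U: "differ f h \<subseteq> U" and V: "differ (T f) (T h) \<subseteq> V"
    using assms(1) unfolding linked_def by blast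
  \<comment> \<open>A point \<open>x\<close> where \<open>f\<close> differs from \<open>h\<close>, together with a function \<open>k\<close> that differs from \<open>h\<close> around \<open>x\<close>
    and whose image differs from that of \<open>h\<close> well inside \<open>V\<close>.\<close>
  define U0 where "U0 = differ f h"
  have "open U0" unfolding U0_def using f h by (rule open_differ)
  obtain y where y: "y \<in> differ (T f) (T h)" using \<open>f \<noteq> h\<close> T_eq_iff[OF f h] by auto
  obtain k' where k': "k' \<in> unif_cont_maps" "k' y \<noteq> T h y" "closure (differ k' (T h)) \<subseteq> differ (T f) (T h)"
    using bump[OF nontrivial_F open_differ[OF T_in[OF f] T_in[OF h]] y T_in[OF h]] by blast
  define k where "k = S k'"
  have k: "k \<in> unif_cont_maps" "T k = k'" using k' by (auto simp: k_def S_in TS)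
  have "differ k h \<subseteq> closure U0" unfolding U0_def
    by (rule differ_subset_closure[OF k(1) f h]) (use k' closure_subset[of "differ k' (T h)"] in \<open>unfold k(2), blast\<close>)
  moreover have "k \<noteq> h" using k k' by auto
  ultimately have "differ k h \<inter> closure U0 \<noteq> {}" by auto
  then have "differ k h \<inter> U0 \<noteq> {}" using open_Int_closure_eq_empty[OF open_differ[OF k(1) h]] by blast
  then obtain x where x: "x \<in> differ k h \<inter> U0" by blast
  have "open (differ k h \<inter> U0)" using open_differ[OF k(1) h] \<open>open U0\<close> by blast
  then obtain \<rho> where \<rho>: "0 < \<rho>" "ball x \<rho> \<subseteq> differ k h \<inter> U0" using x open_contains_ball by blast

  \<comment> \<open>The interpolation \<open>m\<close>: equal to \<open>h\<close> on \<open>W\<close> and to \<open>q\<close> outside \<open>U0\<close>.\<close>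
  define G where "G z = h z - q z" for z
  have G: "G \<in> unif_cont_maps" using unif_cont_diff[OF h q] by (simp add: G_def[abs_def])
  obtain a where a: "a \<in> unif_cont_maps" "a x = norm (G x) + 1" "\<And>z. \<rho> \<le> dist x z \<Longrightarrow> a z = 0"
    using tent[OF \<rho>(1)] by blast
  define m where "m z = q z + clip (a z) (G z)" for z
  have m: "m \<in> unif_cont_maps"
    using unif_cont_add[OF q unif_cont_clip[OF a(1) G]] by (simp add: m_def[abs_def])
  have m_out: "m z = q z" if "z \<notin> U0" for z
  proof -
    have "\<rho> \<le> dist x z" using that \<rho>(2) by (force simp: subset_eq)
    then show ?thesis using a(3) by (simp add: m_def clip_eq_0)
  qed
  have "\<forall>\<^sub>F z in nhds x. norm (G z) < a z"
    using a G by (intro eventually_nhds_less isCont_norm unif_cont_isCont) auto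
  then obtain W0 where W0: "open W0" "x \<in> W0" "\<And>z. z \<in> W0 \<Longrightarrow> norm (G z) < a z"
    unfolding eventually_nhds by blast
  define W where "W = W0 \<inter> (differ k h \<inter> U0)"
  have W: "open W" "x \<in> W" "W \<subseteq> differ k h" "W \<subseteq> U0"
    using W0 x \<open>open (differ k h \<inter> U0)\<close> by (auto simp: W_def)
  have m_in: "m z = h z" if "z \<in> W" for z
    using W0(3)[of z] that by (simp add: W_def m_def clip_eq_self less_imp_le G_def)

  \<comment> \<open>A difference over \<open>h\<close> inside \<open>W\<close>, moved to the base function \<open>m\<close>.\<close>
  obtain j where j: "j \<in> unif_cont_maps" "j x \<noteq> h x" "closure (differ j h) \<subseteq> W"
    using bump[OF nontrivial_E W(1,2) h] by blast
  have jW: "differ j h \<subseteq> W" using order_trans[OF closure_subset j(3)] .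
  have "differ (T j) (T h) \<subseteq> closure (differ (T k) (T h))"
    by (rule biseparating_pair.differ_subset_closure[OF dual T_in[OF j(1)] T_in[OF k(1)] T_in[OF h]])
      (use jW W(3) j k h ST in auto)
  then have jV: "differ (T j) (T h) \<subseteq> V" using k(2) k'(3) V by blast
  have disj: "\<forall>z. j z = h z \<or> m z = h z" using jW m_in by blast
  define j' where "j' z = j z + m z - h z" for z
  have j': "j' \<in> unif_cont_maps" "differ (T j') (T m) = differ (T j) (T h)"
    using parallelogram[OF j(1) m h disj] by (auto simp: j'_def[abs_def])
  have "j \<noteq> h" using j(2) by auto
  then have "T j \<noteq> T h" using T_eq_iff[OF j(1) h] by simp
  then obtain y2 where y2: "y2 \<in> differ (T j') (T m)" using j'(2) by auto

  \<comment> \<open>A difference over \<open>q\<close> with image inside the set where \<open>T j'\<close> and \<open>T m\<close> differ. If it vanished on \<open>U0\<close>,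
    it could be moved to \<open>m\<close> as well and would be disjoint from \<open>j'\<close> there.\<close>
  obtain i' where i': "i' \<in> unif_cont_maps" "i' y2 \<noteq> T q y2"
    "closure (differ i' (T q)) \<subseteq> differ (T j') (T m)"
    using bump[OF nontrivial_F open_differ[OF T_in[OF j'(1)] T_in[OF m]] y2 T_in[OF q]] by blast
  define i where "i = S i'"
  have i: "i \<in> unif_cont_maps" "T i = i'" using i' by (auto simp: i_def S_in TS)
  have "\<exists>z\<in>U0. i z \<noteq> q z"
  proof (rule ccontr)
    assume "\<not> (\<exists>z\<in>U0. i z \<noteq> q z)"
    then have eq: "i z = q z" if "z \<in> U0" for z using that by blast
    then have "\<forall>z. i z = q z \<or> m z = q z" using m_out by blast
    from parallelogram[OF i(1) m q this]
    have n: "(\<lambda>z. i z + m z - q z) \<in> unif_cont_maps"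
      "differ (T (\<lambda>z. i z + m z - q z)) (T m) = differ (T i) (T q)" by auto
    have "\<forall>z. i z + m z - q z = m z \<or> j' z = m z"
    proof
      fix z show "i z + m z - q z = m z \<or> j' z = m z"
        using eq[of z] jW W(4) by (cases "z \<in> U0") (auto simp: j'_def)
    qed
    then have "\<forall>y. T (\<lambda>z. i z + m z - q z) y = T m y \<or> T j' y = T m y"
      using perp[OF n(1) j'(1) m] by blast
    then show False using n(2) i(2) i'(2) y2 by blast
  qed
  then obtain x2 where x2: "x2 \<in> differ i q \<inter> U0" by blast
  have "open (differ i q \<inter> U0)" using open_differ[OF i(1) q] \<open>open U0\<close> by blast
  then obtain l where l: "l \<in> unif_cont_maps" "l x2 \<noteq> q x2" "closure (differ l q) \<subseteq> differ i q \<inter> U0"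
    using bump[OF nontrivial_E _ x2 q] by blast
  have lsub: "differ l q \<subseteq> differ i q \<inter> U0" using order_trans[OF closure_subset l(3)] .
  have "differ (T l) (T q) \<subseteq> closure (differ (T i) (T q))"
    by (rule biseparating_pair.differ_subset_closure[OF dual T_in[OF l(1)] T_in[OF i(1)] T_in[OF q]])
      (use lsub l i q ST in auto)
  then have "differ (T l) (T q) \<subseteq> V" using i(2) i'(3) j'(2) jV by blast
  moreover have "differ l q \<subseteq> U" using lsub U by (auto simp: U0_def)
  ultimately show thesis using that l by blast
qed

text \<open>The step from linked sets to values: a change \<open>j\<close> of \<open>q\<close> with \<open>T j = T q\<close> outside \<open>V\<close> is
  disjoint from \<open>p\<close> relative to \<open>q\<close>, because \<open>T p = T q\<close> on \<open>V\<close>.\<close>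

lemma linked_agree:
  assumes "linked T U V" "p \<in> unif_cont_maps" "q \<in> unif_cont_maps" "\<And>y. y \<in> V \<Longrightarrow> T p y = T q y"
  shows "\<exists>x\<in>U. p x = q x"
proof -
  obtain j where j: "j \<in> unif_cont_maps" "j \<noteq> q" "differ j q \<subseteq> U" "differ (T j) (T q) \<subseteq> V"
    using linked_base_change[OF assms(1,3)] by blast
  have "\<forall>y. T j y = T q y \<or> T p y = T q y" using j(4) assms(4) by blast
  then have "\<forall>x. j x = q x \<or> p x = q x" using perp[OF j(1) assms(2,3)] by blast
  moreover obtain x where "j x \<noteq> q x" using j(2) by auto
  ultimately show ?thesis using j(3) by auto
qed

text \<open>Any \<open>y\<close> works at which the images of \<open>0\<close> and of a bump inside \<open>U\<close> differ: by
  \<open>differ_subset_closure\<close>, a function whose image differs from that of \<open>0\<close> only close to \<open>y\<close> vanishes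
  outside the closure of the set where the bump is nonzero.\<close>

lemma linked_exists:
  assumes "open U" "x \<in> U"
  obtains y where "\<And>V. open V \<Longrightarrow> y \<in> V \<Longrightarrow> linked T U V"
proof -
  let ?h = "\<lambda>_::'x. 0::'e"
  have h: "?h \<in> unif_cont_maps" by (rule unif_cont_const)
  obtain f where f: "f \<in> unif_cont_maps" "f x \<noteq> ?h x" "closure (differ f ?h) \<subseteq> U"
    using bump[OF nontrivial_E assms h] by blast
  then have "T f \<noteq> T ?h" using T_eq_iff[OF f(1) h] by auto
  then obtain y where y: "y \<in> differ (T f) (T ?h)" by auto
  have "linked T U V" if V: "open V" "y \<in> V" for V
  proof -
    have op: "open (V \<inter> differ (T f) (T ?h))"
      using V(1) open_differ[OF T_in[OF f(1)] T_in[OF h]] by (rule open_Int)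
    have mem: "y \<in> V \<inter> differ (T f) (T ?h)" using V(2) y by simp
    then obtain k' where k': "k' \<in> unif_cont_maps" "k' y \<noteq> T ?h y"
      "closure (differ k' (T ?h)) \<subseteq> V \<inter> differ (T f) (T ?h)"
      using bump[OF nontrivial_F op mem T_in[OF h]] by blast
    have sub: "differ k' (T ?h) \<subseteq> V \<inter> differ (T f) (T ?h)"
      using order_trans[OF closure_subset k'(3)] .
    have k: "S k' \<in> unif_cont_maps" "T (S k') = k'" using k' by (auto simp: S_in TS)
    have "differ (S k') ?h \<subseteq> closure (differ f ?h)"
      by (rule differ_subset_closure[OF k(1) f(1) h]) (use k sub in auto)
    moreover have "S k' \<noteq> ?h" using k k'(2) by auto
    ultimately show ?thesis
      unfolding linked_def using k h sub f(3) by (intro bexI[of _ "S k'"] bexI[of _ ?h]) auto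
  qed
  then show thesis by (rule that)
qed

section \<open>The support map\<close>

text \<open>If there is no convergent subsequence, the \<open>y n\<close> can be taken separated. Then there is a
  uniformly continuous \<open>k\<close> that coincides with the image of a constant \<open>e \<noteq> 0\<close> near infinitely many of
  them and with the image of \<open>0\<close> near infinitely many others. By \<open>linked_agree\<close>, \<open>S k\<close> takes the
  values \<open>e\<close> and \<open>0\<close> arbitrarily close to \<open>x\<close>, which contradicts its continuity.\<close>

lemma linked_limit:
  assumes I: "infinite I"
    and L: "\<And>r. 0 < r \<Longrightarrow> \<forall>\<^sub>F n in along I. \<forall>s>0. linked T (ball x r) (ball (y n) s)"
  obtains J l where "J \<subseteq> I" "infinite J" "(y \<longlongrightarrow> l) (along J)"
  using I
proof (cases rule: convergent_or_separated[where z = y])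
  case (separated J s)
  obtain e :: 'e where e: "e \<noteq> 0" using nontrivial_E by blast
  define g where "g c = T (\<lambda>_. c)" for c
  have g: "g c \<in> unif_cont_maps" for c by (simp add: g_def T_in unif_cont_const)
  define G where "G z = g e z - g 0 z" for z
  have G: "G \<in> unif_cont_maps" using unif_cont_diff[OF g g] by (simp add: G_def[abs_def])
  obtain \<delta> C where C: "0 < \<delta>" "0 < C"
    "\<And>a b. a = b \<or> s \<le> dist a b \<Longrightarrow> ereal (norm (G a - G b)) \<le> ereal C * chain_dist \<delta> a b"
    using unif_cont_u_sequence[OF G separated(3)] by blast
  have "ereal (norm (G (y n) - G (y m))) \<le> ereal C * chain_dist \<delta> (y n) (y m)" if "m \<in> J" "n \<in> J" for m n
    using that separated(4) by (intro C(3)) (auto simp: separated_on_def)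
  from chain_ball_radii[OF separated(2-4) less_imp_le[OF C(2)] this]
  obtain J' \<rho> K where J': "J' \<subseteq> J" "infinite J'" "disjoint_chain_balls \<delta> y \<rho> J'"
    "\<And>n. n \<in> J' \<Longrightarrow> norm (G (y n)) + 1 \<le> K * \<rho> n" by metis
  have \<rho>: "0 < \<rho> n" if "n \<in> J'" for n using J'(3) that by (auto simp: disjoint_chain_balls_def)
  obtain M where M: "M \<subseteq> J'" "infinite M" "infinite (J' - M)" using infinite_split[OF J'(2)] by blast
  have adm: "admissible_heights (\<lambda>n. norm (G (y n)) + 1) \<rho> J'"
    using J'(4) \<rho> by (rule admissible_heights_linear)
  obtain H where H: "H \<in> unif_cont_maps" "\<And>i. i \<in> J' \<inter> M \<Longrightarrow> \<forall>\<^sub>F z in nhds (y i). H z = G z"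
    "\<And>i. i \<in> J' - M \<Longrightarrow> \<forall>\<^sub>F z in nhds (y i). H z = 0"
    by (rule alternate[OF G C(1) J'(3) _ _ adm, of M]) (auto simp: add_nonneg_pos)
  define k where "k z = g 0 z + H z" for z
  have k: "k \<in> unif_cont_maps" using unif_cont_add[OF g H(1)] by (simp add: k_def[abs_def])
  have const_value: "S k x = c" if N: "infinite N" "N \<subseteq> I" "\<And>i. i \<in> N \<Longrightarrow> \<forall>\<^sub>F z in nhds (y i). k z = g c z" for c N
  proof (rule ccontr)
    assume "S k x \<noteq> c"
    then have "\<forall>\<^sub>F z in nhds x. S k z \<noteq> c"
      using unif_cont_isCont[OF S_in[OF k], of x]
      by (metis isCont_def tendsto_at_iff_tendsto_nhds tendsto_imp_eventually_ne)
    then obtain r where r: "0 < r" "\<And>z. dist z x < r \<Longrightarrow> S k z \<noteq> c"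
      unfolding eventually_nhds_metric by blast
    obtain n where n: "n \<in> N" "\<forall>s>0. linked T (ball x r) (ball (y n) s)"
      using eventually_along_ex[OF filter_leD[OF along_mono[OF N(2)] L[OF r(1)]] N(1)] by blast
    obtain s where s: "0 < s" "\<And>z. dist z (y n) < s \<Longrightarrow> k z = g c z"
      using N(3)[OF n(1)] unfolding eventually_nhds_metric by blast
    have "\<exists>z\<in>ball x r. S k z = (\<lambda>_. c) z"
      by (rule linked_agree[of _ "ball (y n) s"])
        (use n s k in \<open>auto simp: S_in TS unif_cont_const g_def dist_commute\<close>)
    then show False using r(2) by (auto simp: dist_commute)
  qed
  have "S k x = e"
  proof (rule const_value)
    fix i assume "i \<in> M"
    then have "\<forall>\<^sub>F z in nhds (y i). H z = G z" using H(2) M(1) by blast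
    then show "\<forall>\<^sub>F z in nhds (y i). k z = g e z" by (rule eventually_mono) (simp add: k_def G_def)
  qed (use M J' separated in auto)
  moreover have "S k x = 0"
  proof (rule const_value)
    fix i assume "i \<in> J' - M"
    then have "\<forall>\<^sub>F z in nhds (y i). H z = 0" using H(3) by blast
    then show "\<forall>\<^sub>F z in nhds (y i). k z = g 0 z" by (rule eventually_mono) (simp add: k_def)
  qed (use M J' separated in auto)
  ultimately show thesis using e by simp
qed (use that in blast)

lemma corresponds_limit:
  assumes J: "infinite J" "(y \<longlongrightarrow> l) (along J)"
    and L: "\<And>r. 0 < r \<Longrightarrow> \<forall>\<^sub>F n in along J. \<forall>s>0. linked T (ball x r) (ball (y n) s)"
  shows "corresponds T x l"
  unfolding corresponds_def
proof (intro allI impI)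
  fix r :: real assume "0 < r"
  then have "\<forall>\<^sub>F n in along J. dist (y n) l < r/2" by (intro tendstoD[OF J(2)]) simp
  then have "\<forall>\<^sub>F n in along J. dist (y n) l < r/2 \<and> (\<forall>s>0. linked T (ball x r) (ball (y n) s))"
    using L[OF \<open>0 < r\<close>] by (rule eventually_conj)
  from eventually_along_ex[OF this J(1)] \<open>0 < r\<close>
  obtain n where n: "dist (y n) l < r/2" "linked T (ball x r) (ball (y n) (r/2))"
    by (meson half_gt_zero)
  have "ball (y n) (r/2) \<subseteq> ball l r"
    by (rule ball_subset_ball) (use n(1) in simp)
  then show "linked T (ball x r) (ball l r)" using linked_mono[OF n(2)] by blast
qed

lemma corresponds_exists: "\<exists>y. corresponds T x y"
proof -
  have "\<exists>y. \<forall>V. open V \<longrightarrow> y \<in> V \<longrightarrow> linked T (ball x (1 / Suc n)) V" for n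
    using linked_exists[of "ball x (1 / Suc n)" x] by (metis centre_in_ball open_ball of_nat_0_less_iff zero_less_Suc zero_less_divide_1_iff)
  then obtain y where y: "\<And>n V. open V \<Longrightarrow> y n \<in> V \<Longrightarrow> linked T (ball x (1 / Suc n)) V" by metis
  have L: "\<forall>\<^sub>F n in along J. \<forall>s>0. linked T (ball x r) (ball (y n) s)" if "0 < r" for r J
  proof -
    obtain N where N: "1 / real (Suc N) < r" using \<open>0 < r\<close> nat_approx_posE by blast
    have "linked T (ball x r) (ball (y n) s)" if "N \<le> n" "0 < s" for n s
    proof (rule linked_mono[OF y[of "ball (y n) s" n]])
      have "1 / real (Suc n) \<le> 1 / real (Suc N)" using that by (simp add: frac_le)
      then show "ball x (1 / real (Suc n)) \<subseteq> ball x r" using N by (intro subset_ball) simp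
    qed (use that in auto)
    then show ?thesis by (auto simp: eventually_along)
  qed
  obtain J l where "infinite J" "(y \<longlongrightarrow> l) (along J)"
    by (rule linked_limit[OF infinite_UNIV_nat L])
  then show ?thesis using corresponds_limit[OF _ _ L] by blast
qed

lemma corresponds_agree_S:
  assumes c: "corresponds T x y" and p: "p \<in> unif_cont_maps" "q \<in> unif_cont_maps"
    and eq: "\<forall>\<^sub>F z in nhds y. T p z = T q z"
  shows "p x = q x"
proof (rule ccontr)
  assume "p x \<noteq> q x"
  then obtain r where r: "0 < r" "ball x r \<subseteq> differ p q"
    using open_differ[OF p] open_contains_ball[of "differ p q"] by blast
  obtain s where s: "0 < s" "\<And>z. dist z y < s \<Longrightarrow> T p z = T q z"
    using eq unfolding eventually_nhds_metric by blast
  have "linked T (ball x (min r s)) (ball y (min r s))" using c r(1) s(1) by (simp add: corresponds_def)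
  then have "linked T (ball x r) (ball y s)" by (rule linked_mono) auto
  then show False using linked_agree[OF _ p, of "ball x r" "ball y s"] s(2) r(2) by (force simp: dist_commute)
qed

text \<open>As in \<open>linked_limit\<close>, with two different points in place of a separated sequence.\<close>

lemma corresponds_unique:
  assumes c: "corresponds T x y" "corresponds T x y'"
  shows "y = y'"
proof (rule ccontr)
  assume "y \<noteq> y'"
  obtain e :: 'e where e: "e \<noteq> 0" using nontrivial_E by blast
  define g where "g c = T (\<lambda>_. c)" for c
  have g: "g c \<in> unif_cont_maps" for c by (simp add: g_def T_in unif_cont_const)
  define G where "G z = g e z - g 0 z" for z
  have G: "G \<in> unif_cont_maps" using unif_cont_diff[OF g g] by (simp add: G_def[abs_def])
  let ?z = "\<lambda>i::nat. if i = 0 then y else y'"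
  define D where "D = dist y y' / 2"
  have D: "0 < D" "2 * D = dist y y'" using \<open>y \<noteq> y'\<close> by (auto simp: D_def)
  have disj: "disjoint_chain_balls 1 ?z (\<lambda>_. D) {0, 1}"
    by (rule disjoint_chain_balls_if_dist) (use D in auto)
  define b where "b i = norm (G (?z i)) + 1" for i
  have "0 \<le> norm (G y)" "0 \<le> norm (G y')" by auto
  then have "b i \<le> (norm (G y) + norm (G y') + 1) / D * D" if "i \<in> {0, 1}" for i
    using that D(1) by (auto simp: b_def simp del: norm_ge_zero)
  then have adm: "admissible_heights b (\<lambda>_. D) {0, 1}"
    using D(1) by (rule admissible_heights_linear)
  obtain H where H: "H \<in> unif_cont_maps"
    "\<And>i. i \<in> {0, 1} \<inter> {0} \<Longrightarrow> \<forall>\<^sub>F z in nhds (?z i). H z = G z"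
    "\<And>i. i \<in> {0, 1} - {0} \<Longrightarrow> \<forall>\<^sub>F z in nhds (?z i). H z = 0"
    by (rule alternate[OF G zero_less_one disj _ _ adm, of "{0}"]) (auto simp: b_def add_nonneg_pos)
  define k where "k z = g 0 z + H z" for z
  have k: "k \<in> unif_cont_maps" using unif_cont_add[OF g H(1)] by (simp add: k_def[abs_def])
  have "\<forall>\<^sub>F z in nhds y. T (S k) z = T (\<lambda>_. e) z"
    using H(2)[of 0] by simp (erule eventually_mono, simp add: TS k k_def G_def g_def)
  then have "S k x = e" using corresponds_agree_S[OF c(1) S_in[OF k] unif_cont_const] by blast
  moreover have "\<forall>\<^sub>F z in nhds y'. T (S k) z = T (\<lambda>_. 0) z"
    using H(3)[of 1] by simp (erule eventually_mono, simp add: TS k k_def G_def g_def)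
  then have "S k x = 0" using corresponds_agree_S[OF c(2) S_in[OF k] unif_cont_const] by blast
  ultimately show False using e by simp
qed

abbreviation "\<phi> \<equiv> support_map T"

lemma corresponds_iff: "corresponds T x y \<longleftrightarrow> \<phi> x = y"
  unfolding support_map_def using corresponds_exists corresponds_unique by (metis the_equality)

lemma support_map_inverse: "support_map S (\<phi> x) = x"
  using biseparating_pair.corresponds_iff[OF dual] corresponds_dual corresponds_iff by blast

lemma corresponds_support_map: "linked T (ball x r) (ball (\<phi> x) r)" if "0 < r"
  using corresponds_iff[of x "\<phi> x"] that by (simp add: corresponds_def)

lemma agree_near:
  assumes "f \<in> unif_cont_maps" "g \<in> unif_cont_maps" "\<forall>\<^sub>F z in nhds x. f z = g z"
  shows "T f (\<phi> x) = T g (\<phi> x)"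
  by (rule biseparating_pair.corresponds_agree_S[OF dual, of _ x])
    (use assms in \<open>auto simp: corresponds_dual corresponds_iff T_in ST\<close>)

text \<open>By \<open>linked_limit\<close>, a subsequence of the images staying away from \<open>\<phi> l\<close> would have a further
  subsequence that converges to a point corresponding to \<open>l\<close>.\<close>

lemma support_map_tendsto:
  assumes lim: "(x \<longlongrightarrow> l) (along I)"
  shows "((\<lambda>n. \<phi> (x n)) \<longlongrightarrow> \<phi> l) (along I)"
proof (rule ccontr)
  assume "\<not> ((\<lambda>n. \<phi> (x n)) \<longlongrightarrow> \<phi> l) (along I)"
  then obtain \<epsilon> where \<epsilon>: "0 < \<epsilon>" "\<not> (\<forall>\<^sub>F n in along I. dist (\<phi> (x n)) (\<phi> l) < \<epsilon>)"
    unfolding tendsto_iff by blast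
  define J where "J = {n\<in>I. \<not> dist (\<phi> (x n)) (\<phi> l) < \<epsilon>}"
  have J: "infinite J" "J \<subseteq> I" using not_eventually_along[OF \<epsilon>(2)] by (auto simp: J_def)
  have L: "\<forall>\<^sub>F n in along K. \<forall>s>0. linked T (ball l r) (ball (\<phi> (x n)) s)" if "0 < r" "K \<subseteq> J" for r K
  proof -
    have "(x \<longlongrightarrow> l) (along K)" using lim J(2) that(2) by (meson tendsto_along_mono subset_trans)
    then have "\<forall>\<^sub>F n in along K. dist (x n) l < r/2" using \<open>0 < r\<close> by (intro tendstoD) auto
    then show ?thesis
    proof (rule eventually_mono, intro allI impI)
      fix n and s :: real assume "dist (x n) l < r/2" "0 < s"
      then have "ball (x n) (min s (r/2)) \<subseteq> ball l r"
        by (intro ball_subset_ball) auto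
      then show "linked T (ball l r) (ball (\<phi> (x n)) s)"
        using \<open>0 < s\<close> \<open>0 < r\<close> by (intro linked_mono[OF corresponds_support_map[of "min s (r/2)" "x n"]]) auto
    qed
  qed
  obtain K y where K: "K \<subseteq> J" "infinite K" "((\<lambda>n. \<phi> (x n)) \<longlongrightarrow> y) (along K)"
    by (rule linked_limit[OF J(1) L[OF _ subset_refl]])
  have "\<phi> l = y" using corresponds_limit[OF K(2,3) L[OF _ K(1)]] by (simp add: corresponds_iff)
  then have "\<forall>\<^sub>F n in along K. dist (\<phi> (x n)) (\<phi> l) < \<epsilon>" using tendstoD[OF K(3) \<epsilon>(1)] by simp
  then show False using eventually_along_ex[OF _ K(2)] K(1) by (auto simp: J_def)
qed

text \<open>Near a point \<open>x\<close> where \<open>f\<close> and \<open>g\<close> agree without being equal nearby, a function \<open>k\<close> is found that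
  equals \<open>f\<close> near infinitely many and \<open>g\<close> near infinitely many terms of a sequence tending to \<open>x\<close>. By
  continuity of \<open>T k\<close> and of the support map, both \<open>T f\<close> and \<open>T g\<close> have the value of \<open>T k\<close> at \<open>\<phi> x\<close>.\<close>

lemma agree_at:
  assumes f: "f \<in> unif_cont_maps" and g: "g \<in> unif_cont_maps" and eq: "f x = g x"
  shows "T f (\<phi> x) = T g (\<phi> x)"
proof (cases "\<forall>\<^sub>F z in nhds x. f z = g z")
  case True
  then show ?thesis using agree_near f g by blast
next
  case False
  have ex: "\<exists>z. dist z x < 1 / real (Suc n) \<and> f z \<noteq> g z" for n
  proof (rule ccontr)
    assume "\<not> ?thesis"
    then have "\<forall>\<^sub>F z in nhds x. f z = g z"
      unfolding eventually_nhds_metric by (intro exI[of _ "1 / real (Suc n)"]) auto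
    then show False using False by contradiction
  qed
  define u where "u n = (SOME z. dist z x < 1 / real (Suc n) \<and> f z \<noteq> g z)" for n
  have u: "dist (u n) x < 1 / real (Suc n)" "f (u n) \<noteq> g (u n)" for n
    using someI_ex[OF ex[of n]] by (simp_all add: u_def)
  have "(\<lambda>n. dist (u n) x) \<longlonglongrightarrow> 0" using u(1) by (intro tendsto_0_if_less_inverse_Suc) auto
  then have "u \<longlonglongrightarrow> x" using tendsto_dist_iff by blast
  then have u_lim: "(u \<longlongrightarrow> x) (along J)" for J by (rule tendsto_along)
  have ne: "u n \<noteq> x" for n using u(2)[of n] eq by auto
  obtain J where "J \<subseteq> UNIV" and J: "infinite J"
    "\<And>m n. m \<in> J \<Longrightarrow> n \<in> J \<Longrightarrow> m < n \<Longrightarrow> dist (u m) x / 2 + dist (u n) x / 2 \<le> dist (u m) (u n)"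
    by (rule sparse_subset[OF infinite_UNIV_nat u_lim ne]) (rule that)
  define \<rho> where "\<rho> n = dist (u n) x / 2" for n
  have \<rho>: "0 < \<rho> n" for n using ne by (simp add: \<rho>_def)
  have disj: "disjoint_chain_balls 1 u \<rho> J"
    by (rule disjoint_chain_balls_if_dist) (use \<rho> J(2) in \<open>auto simp: \<rho>_def\<close>)
  define G where "G z = f z - g z" for z
  have G: "G \<in> unif_cont_maps" using unif_cont_diff[OF f g] by (simp add: G_def[abs_def])
  have "((\<lambda>n. 2 * norm (G (u n))) \<longlongrightarrow> 2 * norm (G x)) (along J)"
    by (intro tendsto_mult tendsto_const tendsto_norm isCont_tendsto_compose[OF unif_cont_isCont[OF G] u_lim])
  then have adm: "admissible_heights (\<lambda>n. 2 * norm (G (u n))) \<rho> J"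
    using eq \<rho> by (intro admissible_heights_null) (simp_all add: G_def)
  obtain K where K: "K \<subseteq> J" "infinite K" "infinite (J - K)" using infinite_split[OF J(1)] by blast
  obtain H where H: "H \<in> unif_cont_maps" "\<And>i. i \<in> J \<inter> K \<Longrightarrow> \<forall>\<^sub>F z in nhds (u i). H z = G z"
    "\<And>i. i \<in> J - K \<Longrightarrow> \<forall>\<^sub>F z in nhds (u i). H z = 0"
    by (rule alternate[OF G zero_less_one disj _ _ adm, of K]) (use u(2) in \<open>auto simp: G_def\<close>)
  define k where "k z = g z + H z" for z
  have k: "k \<in> unif_cont_maps" using unif_cont_add[OF g H(1)] by (simp add: k_def[abs_def])
  have lim: "((\<lambda>n. T p (\<phi> (u n))) \<longlongrightarrow> T p (\<phi> x)) (along M)" if "p \<in> unif_cont_maps" for p M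
    using unif_cont_isCont[OF T_in[OF that]] support_map_tendsto[OF u_lim] by (rule isCont_tendsto_compose)
  have same: "T k (\<phi> x) = T p (\<phi> x)"
    if "p \<in> unif_cont_maps" "infinite M" "\<And>i. i \<in> M \<Longrightarrow> \<forall>\<^sub>F z in nhds (u i). k z = p z" for p M
  proof (rule tendsto_unique[OF along_nontrivial[OF that(2)] lim[OF k]])
    have "\<forall>\<^sub>F n in along M. T p (\<phi> (u n)) = T k (\<phi> (u n))"
      using agree_near[OF k that(1) that(3)] by (auto simp: eventually_along)
    from Lim_transform_eventually[OF lim[OF that(1)] this]
    show "((\<lambda>n. T k (\<phi> (u n))) \<longlongrightarrow> T p (\<phi> x)) (along M)" .
  qed
  have "T k (\<phi> x) = T f (\<phi> x)"
  proof (rule same[OF f K(2)])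
    fix i assume "i \<in> K"
    then have "\<forall>\<^sub>F z in nhds (u i). H z = G z" using H(2) K(1) by blast
    then show "\<forall>\<^sub>F z in nhds (u i). k z = f z" by (rule eventually_mono) (simp add: k_def G_def)
  qed
  moreover have "T k (\<phi> x) = T g (\<phi> x)"
  proof (rule same[OF g K(3)])
    fix i assume "i \<in> J - K"
    then have "\<forall>\<^sub>F z in nhds (u i). H z = 0" using H(3) by blast
    then show "\<forall>\<^sub>F z in nhds (u i). k z = g z" by (rule eventually_mono) (simp add: k_def)
  qed
  ultimately show ?thesis by simp
qed

lemma support_map_inverse': "\<phi> (support_map S y) = y"
  by (rule biseparating_pair.support_map_inverse[OF dual])

lemma agree_at_S:
  assumes "p \<in> unif_cont_maps" "q \<in> unif_cont_maps" "p (\<phi> x) = q (\<phi> x)"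
  shows "S p x = S q x"
  using biseparating_pair.agree_at[OF dual assms] by (simp add: support_map_inverse)

section \<open>Uniform continuity of the support map\<close>

text \<open>If \<open>d(x\<^sub>n, x'\<^sub>n)\<close> tends to \<open>0\<close>, changing \<open>g\<close> at \<open>y'\<^sub>n = \<phi> x'\<^sub>n\<close> but not at \<open>y\<^sub>n = \<phi> x\<^sub>n\<close> must change the
  value of \<open>S g\<close> at \<open>x'\<^sub>n\<close> less and less, provided that it can be done by a single uniformly continuous
  function. Tents at the \<open>y'\<^sub>n\<close> of heights \<open>w\<^sub>n\<close> must have radii of at least that order. The bound by
  \<open>d\<^sub>\<delta>(y'\<^sub>n, y\<^sub>n)\<close> keeps \<open>y\<^sub>n\<close> outside the tent at \<open>y'\<^sub>n\<close>, and the bound by \<open>G\<close> makes the tents disjoint along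
  a subsequence.\<close>

lemma dominated_change:
  assumes I: "infinite I" and s: "0 < s" "separated_on s (\<lambda>n. \<phi> (x' n)) I"
    and d: "((\<lambda>n. dist (x n) (x' n)) \<longlongrightarrow> 0) (along I)"
    and far: "0 < \<epsilon>" "\<And>n. n \<in> I \<Longrightarrow> \<epsilon> \<le> dist (\<phi> (x n)) (\<phi> (x' n))"
    and g: "g \<in> unif_cont_maps" and G: "G \<in> unif_cont_maps"
    and wG: "\<And>n. n \<in> I \<Longrightarrow> norm (w n) \<le> norm (G (\<phi> (x' n)))"
    and wk: "\<And>n. n \<in> I \<Longrightarrow> ereal (norm (w n)) \<le> ereal k * chain_dist \<delta> (\<phi> (x' n)) (\<phi> (x n))"
    and pos: "0 < \<delta>" "0 < k"
  shows "((\<lambda>n. norm (S (\<lambda>z. g z + w n) (x' n) - S g (x' n))) \<longlongrightarrow> 0) (along I)"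
proof (rule ccontr)
  assume "\<not> ?thesis"
  then obtain J c where J: "J \<subseteq> I" "infinite J" "0 < c"
    "\<And>n. n \<in> J \<Longrightarrow> c \<le> norm (S (\<lambda>z. g z + w n) (x' n) - S g (x' n))"
    by (rule not_tendsto_along) auto
  let ?y = "\<lambda>n. \<phi> (x n)" and ?y' = "\<lambda>n. \<phi> (x' n)"
  obtain \<delta>0 C where C: "0 < \<delta>0" "0 < C"
    "\<And>a b. a = b \<or> s \<le> dist a b \<Longrightarrow> ereal (norm (G a - G b)) \<le> ereal C * chain_dist \<delta>0 a b"
    using unif_cont_u_sequence[OF G s(1)] by blast
  define \<eta> where "\<eta> = min \<delta> \<delta>0"
  have "0 < \<eta>" using pos C by (simp add: \<eta>_def)
  have sepJ: "separated_on s ?y' J" using separated_on_subset[OF s(2) J(1)] .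
  have le: "ereal (norm (G (?y' n) - G (?y' m))) \<le> ereal C * chain_dist \<eta> (?y' n) (?y' m)"
    if "m \<in> J" "n \<in> J" for m n
  proof -
    have "ereal (norm (G (?y' n) - G (?y' m))) \<le> ereal C * chain_dist \<delta>0 (?y' n) (?y' m)"
      using that sepJ by (intro C(3)) (auto simp: separated_on_def)
    also have "\<dots> \<le> ereal C * chain_dist \<eta> (?y' n) (?y' m)"
      using C(2) by (intro ereal_mult_left_mono chain_dist_antimono) (auto simp: \<eta>_def)
    finally show ?thesis .
  qed
  obtain J1 \<rho> K where J1: "J1 \<subseteq> J" "infinite J1" "disjoint_chain_balls \<eta> ?y' \<rho> J1"
    "\<And>n. n \<in> J1 \<Longrightarrow> norm (G (?y' n)) + 1 \<le> K * \<rho> n"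
    by (rule chain_ball_radii[OF J(2) s(1) sepJ less_imp_le[OF C(2)] le]) (assumption+, rule that)
  have \<rho>: "0 < \<rho> n" if "n \<in> J1" for n using J1(3) that by (auto simp: disjoint_chain_balls_def)
  \<comment> \<open>The radii are shrunk so that the ball around \<open>\<phi> (x' n)\<close> does not contain \<open>\<phi> (x n)\<close>; \<open>avoid_subset\<close> takes
    care of the points \<open>\<phi> (x m)\<close> with \<open>m \<noteq> n\<close>.\<close>
  define \<sigma> where "\<sigma> n = capped_chain_dist \<eta> (\<rho> n) (?y' n) (?y n)" for n
  have \<sigma>: "ereal (\<sigma> n) = min (ereal (\<rho> n)) (chain_dist \<eta> (?y' n) (?y n))" if "n \<in> J1" for n
    unfolding \<sigma>_def using \<rho>[OF that] by (intro ereal_capped_chain_dist) simp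
  have \<sigma>_le: "\<sigma> n \<le> \<rho> n" if "n \<in> J1" for n
    using \<sigma>[OF that] by (metis ereal_less_eq(3) min.cobounded1)
  have \<sigma>_pos: "0 < \<sigma> n" if "n \<in> J1" for n
  proof -
    have "ereal \<epsilon> \<le> ereal (dist (?y' n) (?y n))" using far(2)[of n] that J1(1) J(1) by (auto simp: dist_commute)
    also have "\<dots> \<le> chain_dist \<eta> (?y' n) (?y n)" by (rule dist_le_chain_dist)
    finally have "0 < chain_dist \<eta> (?y' n) (?y n)" using far(1) by (meson ereal_less(2) less_le_trans)
    then have "0 < ereal (\<sigma> n)" using \<sigma>[OF that] \<rho>[OF that] by (simp add: min_def)
    then show ?thesis by simp
  qed
  have disj: "disjoint_chain_balls \<eta> ?y' \<sigma> J1"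
    unfolding disjoint_chain_balls_def
  proof (intro conjI ballI impI)
    fix i j assume ij: "i \<in> J1" "j \<in> J1" "i \<noteq> j"
    then have "ereal (\<sigma> i + \<sigma> j) \<le> ereal (\<rho> i + \<rho> j)" using \<sigma>_le by (simp add: add_mono)
    also have "\<dots> \<le> chain_dist \<eta> (?y' i) (?y' j)" using J1(3) ij by (auto simp: disjoint_chain_balls_def)
    finally show "ereal (\<sigma> i + \<sigma> j) \<le> chain_dist \<eta> (?y' i) (?y' j)" .
  qed (rule \<sigma>_pos)
  have w\<sigma>: "norm (w n) \<le> max k K * \<sigma> n" if "n \<in> J1" for n
  proof (cases "ereal (\<rho> n) \<le> chain_dist \<eta> (?y' n) (?y n)")
    case True
    then have "\<sigma> n = \<rho> n" using \<sigma>[OF that] by (simp add: min_def)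
    have "norm (w n) \<le> K * \<rho> n" using wG[of n] J1(4)[OF that] that J1(1) J(1) by fastforce
    also have "\<dots> \<le> max k K * \<rho> n" using \<rho>[OF that] by (intro mult_right_mono) auto
    finally show ?thesis using \<open>\<sigma> n = \<rho> n\<close> by simp
  next
    case False
    then have eq: "ereal (\<sigma> n) = chain_dist \<eta> (?y' n) (?y n)" using \<sigma>[OF that] by (simp add: min_def)
    have "ereal (norm (w n)) \<le> ereal k * chain_dist \<delta> (?y' n) (?y n)"
      using wk[of n] that J1(1) J(1) by blast
    also have "\<dots> \<le> ereal k * chain_dist \<eta> (?y' n) (?y n)"
      using pos by (intro ereal_mult_left_mono chain_dist_antimono) (auto simp: \<eta>_def)
    finally have "norm (w n) \<le> k * \<sigma> n" unfolding eq[symmetric] by simp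
    also have "\<dots> \<le> max k K * \<sigma> n" using \<sigma>_pos[OF that] by (intro mult_right_mono) auto
    finally show ?thesis .
  qed
  let ?B = "\<lambda>n. {z. chain_dist \<eta> (?y' n) z < ereal (\<sigma> n)}"
  have own: "?y n \<notin> ?B n" if "n \<in> J1" for n using \<sigma>[OF that] by simp
  obtain J2 where J2: "J2 \<subseteq> J1" "infinite J2" "\<And>m n. m \<in> J2 \<Longrightarrow> n \<in> J2 \<Longrightarrow> ?y m \<notin> ?B n"
    by (rule avoid_subset[OF J1(2) own chain_balls_disjoint[OF disj]]) (assumption+, rule that)
  have adm: "admissible_heights (\<lambda>n. norm (w n)) \<sigma> J2"
    by (rule admissible_heights_linear[of _ _ "max k K"]) (use w\<sigma> \<sigma>_pos J2(1) in auto)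
  obtain h where h: "h \<in> unif_cont_maps" "\<And>n. n \<in> J2 \<Longrightarrow> h (?y' n) = w n"
    "\<And>z. (\<And>n. n \<in> J2 \<Longrightarrow> ereal (\<sigma> n) \<le> chain_dist \<eta> (?y' n) z) \<Longrightarrow> h z = 0"
    by (rule tents[OF \<open>0 < \<eta>\<close> disjoint_chain_balls_subset[OF disj J2(1)] adm])
      (rule that, assumption, simp, simp)
  have h0: "h (?y n) = 0" if "n \<in> J2" for n using J2(3)[OF that] by (intro h(3)) (simp add: not_less)
  define p where "p z = S (\<lambda>z. g z + h z) z - S g z" for z
  have gh: "(\<lambda>z. g z + h z) \<in> unif_cont_maps" by (rule unif_cont_add[OF g h(1)])
  have p: "p \<in> unif_cont_maps" using unif_cont_diff[OF S_in[OF gh] S_in[OF g]] by (simp add: p_def[abs_def])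
  have "p (x' n) = S (\<lambda>z. g z + w n) (x' n) - S g (x' n)" if "n \<in> J2" for n
    unfolding p_def using agree_at_S[OF gh unif_cont_add[OF g unif_cont_const], of "x' n" "w n"] h(2)[OF that]
    by simp
  then have big: "c \<le> norm (p (x' n))" if "n \<in> J2" for n using J(4)[of n] that J2(1) J1(1) by auto
  have zero: "p (x n) = 0" if "n \<in> J2" for n
    unfolding p_def using agree_at_S[OF gh g, of "x n"] h0[OF that] by simp
  have "J2 \<subseteq> I" using J2(1) J1(1) J(1) by blast
  have "((\<lambda>n. norm (p (x n) - p (x' n))) \<longlongrightarrow> 0) (along J2)"
    by (rule unif_cont_along[OF p tendsto_along_mono[OF d \<open>J2 \<subseteq> I\<close>]])
  then have "\<forall>\<^sub>F n in along J2. norm (p (x n) - p (x' n)) < c" using J(3) by (rule order_tendstoD(2))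
  from eventually_along_ex[OF this J2(2)] obtain n where "n \<in> J2" "norm (p (x n) - p (x' n)) < c" by blast
  then show False using big[of n] zero[of n] by simp
qed

text \<open>Let \<open>D\<^sub>k(n)\<close> be the chain distance of \<open>y'\<^sub>n\<close> and \<open>y\<^sub>n\<close> at scale \<open>1/(k+1)\<close>. By \<open>dominated_change\<close>, for fixed
  \<open>k\<close> and large \<open>n\<close>, changes \<open>w\<close> at \<open>y'\<^sub>n\<close> up to \<open>(k+1) D\<^sub>k(n)\<close> affect the preimage at \<open>x'\<^sub>n\<close> by at most
  \<open>1/(k+1)\<close> only. Choosing such an \<open>n = \<nu> k\<close> for each \<open>k\<close>, changes of size \<open>2/(k+1)\<close> at \<open>x'\<^sub>n\<close> must come
  from changes at \<open>y'\<^sub>n\<close> exceeding \<open>(k+1) D\<^sub>k(n)\<close>. As these changes tend to \<open>0\<close>, they can be realised by a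
  uniformly continuous function, whose image violates the bound by chain distances.\<close>

lemma support_map_unif_cont: "uniformly_continuous_on UNIV \<phi>"
proof (rule ccontr)
  assume "\<not> ?thesis"
  then obtain \<epsilon> where \<epsilon>: "0 < \<epsilon>" and bad: "\<And>d. 0 < d \<Longrightarrow> \<exists>u v. dist u v < d \<and> \<epsilon> \<le> dist (\<phi> u) (\<phi> v)"
    unfolding uniformly_continuous_on_def by (force simp: not_less)
  have "\<exists>u v. dist u v < 1 / real (Suc n) \<and> \<epsilon> \<le> dist (\<phi> u) (\<phi> v)" for n by (rule bad) simp
  then obtain x x' where close: "\<And>n. dist (x n) (x' n) < 1 / real (Suc n)"
    and far: "\<And>n. \<epsilon> \<le> dist (\<phi> (x n)) (\<phi> (x' n))" by metis
  have d: "((\<lambda>n. dist (x n) (x' n)) \<longlongrightarrow> 0) (along J)" for J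
    using close by (intro tendsto_along tendsto_0_if_less_inverse_Suc) auto
  have noconv: False if "infinite J" "(x \<longlongrightarrow> l) (along J)" for J l
  proof -
    have "(x' \<longlongrightarrow> l) (along J)" by (rule tendsto_close[OF that(2) d])
    then have "((\<lambda>n. dist (\<phi> (x n)) (\<phi> (x' n))) \<longlongrightarrow> dist (\<phi> l) (\<phi> l)) (along J)"
      by (intro tendsto_dist support_map_tendsto that(2))
    then have "\<forall>\<^sub>F n in along J. dist (\<phi> (x n)) (\<phi> (x' n)) < \<epsilon>"
      by (rule order_tendstoD(2)) (use \<epsilon> in simp)
    from eventually_along_ex[OF this that(1)] show False using far by (meson not_less)
  qed
  \<comment> \<open>Neither \<open>x\<close> nor, by continuity of the inverse support map, \<open>\<phi> (x' n)\<close> has a convergent subsequence.\<close>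
  obtain J1 s where J1: "infinite J1" "0 < s" "separated_on s x J1"
    using infinite_UNIV_nat
    by (rule convergent_or_separated[where z = x]) (use noconv in blast)+
  let ?y = "\<lambda>n. \<phi> (x n)" and ?y' = "\<lambda>n. \<phi> (x' n)"
  obtain J2 t where J2: "J2 \<subseteq> J1" "infinite J2" "0 < t" "separated_on t ?y' J2"
    using J1(1)
  proof (rule convergent_or_separated[where z = ?y'])
    fix J l assume J: "infinite J" "(?y' \<longlongrightarrow> l) (along J)"
    have "(x' \<longlongrightarrow> support_map S l) (along J)"
      using biseparating_pair.support_map_tendsto[OF dual J(2)] by (simp add: support_map_inverse)
    moreover have "((\<lambda>n. dist (x' n) (x n)) \<longlongrightarrow> 0) (along J)" using d[of J] by (simp add: dist_commute)
    ultimately have "(x \<longlongrightarrow> support_map S l) (along J)" by (rule tendsto_close)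
    then show thesis using noconv[OF J(1)] by blast
  qed blast
  obtain e :: 'e where e: "e \<noteq> 0" using nontrivial_E by blast
  define g where "g = T (\<lambda>_. 0)"
  have g: "g \<in> unif_cont_maps" "S g = (\<lambda>_. 0)" by (auto simp: g_def T_in ST unif_cont_const)
  define G where "G z = T (\<lambda>_. e) z - g z" for z
  have G: "G \<in> unif_cont_maps"
    using unif_cont_diff[OF T_in[OF unif_cont_const] g(1)] by (simp add: G_def[abs_def])
  define \<psi> where "\<psi> n w = S (\<lambda>z. g z + w) (x' n)" for n w
  define D where "D k n = chain_dist (1 / real (Suc k)) (?y' n) (?y n)" for k n
  \<comment> \<open>The bound by \<open>G\<close> is the one that \<open>dominated_change\<close> requires. It is harmless: \<open>w = G (\<phi> (x' n))\<close> itself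
    leads to the value \<open>e\<close>, which is not small, so that \<open>(k+1) D\<^sub>k(n)\<close> is the smaller bound for large \<open>k\<close>.\<close>
  define good where "good k n \<longleftrightarrow> (\<forall>w. norm w \<le> norm (G (?y' n)) \<longrightarrow>
     ereal (norm w) \<le> ereal (real (Suc k)) * D k n \<longrightarrow> norm (\<psi> n w) \<le> 1 / real (Suc k))" for k n
  have ev_good: "\<forall>\<^sub>F n in along J2. good k n" for k
  proof (rule ccontr)
    assume "\<not> ?thesis"
    then have inf: "infinite {n\<in>J2. \<not> good k n}" (is "infinite ?N") by (rule not_eventually_along)
    have "\<forall>n. \<exists>w. n \<in> ?N \<longrightarrow> norm w \<le> norm (G (?y' n)) \<and>
        ereal (norm w) \<le> ereal (real (Suc k)) * D k n \<and> 1 / real (Suc k) < norm (\<psi> n w)"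
      unfolding good_def by (simp add: not_le)
    from choice[OF this] obtain w where w: "\<And>n. n \<in> ?N \<Longrightarrow> norm (w n) \<le> norm (G (?y' n))"
      "\<And>n. n \<in> ?N \<Longrightarrow> ereal (norm (w n)) \<le> ereal (real (Suc k)) * D k n"
      "\<And>n. n \<in> ?N \<Longrightarrow> 1 / real (Suc k) < norm (\<psi> n (w n))" by blast
    have "((\<lambda>n. norm (S (\<lambda>z. g z + w n) (x' n) - S g (x' n))) \<longlongrightarrow> 0) (along ?N)"
    proof (rule dominated_change[OF inf J2(3) _ d \<epsilon> far g(1) G w(1) w(2)[unfolded D_def]])
      show "separated_on t ?y' ?N" using J2(4) by (rule separated_on_subset) auto
    qed auto
    then have "\<forall>\<^sub>F n in along ?N. norm (\<psi> n (w n)) < 1 / real (Suc k)"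
      unfolding g(2) \<psi>_def by (intro order_tendstoD(2)[where y = 0]) simp_all
    from eventually_along_ex[OF this inf] show False using w(3) by force
  qed
  have step: "\<exists>n. n \<in> J2 \<and> good k n \<and> m < n" for k m
  proof -
    have "infinite {n\<in>J2. good k n}" by (rule eventually_along_infinite[OF ev_good J2(2)])
    then show ?thesis unfolding infinite_nat_iff_unbounded by blast
  qed
  have "\<exists>\<nu>. \<forall>k. (\<nu> k \<in> J2 \<and> good k (\<nu> k)) \<and> \<nu> k < \<nu> (Suc k)"
    by (rule dependent_nat_choice) (use step in blast)+
  then obtain \<nu> where \<nu>: "\<And>k. \<nu> k \<in> J2" "\<And>k. good k (\<nu> k)" "\<And>k. \<nu> k < \<nu> (Suc k)" by blast
  have mono: "strict_mono \<nu>" using \<nu>(3) by (simp add: strict_mono_Suc_iff)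
  \<comment> \<open>The norm of \<open>a k\<close> exceeds the bound \<open>1/(k+1)\<close> in \<open>good\<close>, but still tends to \<open>0\<close>.\<close>
  define a where "a k = (2 / real (Suc k) / norm e) *\<^sub>R e" for k
  have norm_a: "norm (a k) = 2 / real (Suc k)" for k using e by (simp add: a_def)
  have a_lim: "((\<lambda>k. norm (a k)) \<longlongrightarrow> 0) (along UNIV)"
    unfolding norm_a along_UNIV
    using tendsto_mult[OF tendsto_const LIMSEQ_Suc[OF lim_1_over_n], of "2::real"] by simp
  obtain J3 f where J3: "infinite J3" and f: "f \<in> unif_cont_maps"
    "\<And>k. k \<in> J3 \<Longrightarrow> f (x' (\<nu> k)) = a k" "\<And>k. k \<in> J3 \<Longrightarrow> f (x (\<nu> k)) = 0"
  proof (rule perturb_near_separated[OF infinite_UNIV_nat J1(2) _ _ _ a_lim, of "\<lambda>k. x (\<nu> k)" "\<lambda>k. x' (\<nu> k)"])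
    show "separated_on s (\<lambda>k. x (\<nu> k)) UNIV"
      using J1(3) J2(1) \<nu>(1) strict_mono_eq[OF mono] unfolding separated_on_def by blast
    show "((\<lambda>k. dist (x (\<nu> k)) (x' (\<nu> k))) \<longlongrightarrow> 0) (along UNIV)"
      using LIMSEQ_subseq_LIMSEQ[OF _ mono, of "\<lambda>n. dist (x n) (x' n)"] d[of UNIV] by (simp add: o_def)
    show "x (\<nu> k) \<noteq> x' (\<nu> k)" for k using far[of "\<nu> k"] \<epsilon> by auto
  qed (rule that)
  define h where "h z = T f z - g z" for z
  have h: "h \<in> unif_cont_maps" using unif_cont_diff[OF T_in[OF f(1)] g(1)] by (simp add: h_def[abs_def])
  have h0: "h (?y (\<nu> k)) = 0" if "k \<in> J3" for k
    unfolding h_def g_def using agree_at[OF f(1) unif_cont_const] f(3)[OF that] by simp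
  have \<psi>_eq: "\<psi> n (T p (?y' n) - g (?y' n)) = p (x' n)" if "p \<in> unif_cont_maps" for p n
    unfolding \<psi>_def using agree_at_S[OF unif_cont_add[OF g(1) unif_cont_const] T_in[OF that],
        of "x' n" "T p (?y' n) - g (?y' n)"] by (simp add: ST[OF that])
  obtain \<delta> C where C: "0 < \<delta>" "0 < C" "\<And>a b. ereal (norm (h a - h b)) \<le> 1 + ereal C * chain_dist \<delta> a b"
    using unif_cont_norm_le_chain_dist[OF h] by blast
  \<comment> \<open>The summands make \<open>k\<close> large enough for, in this order: \<open>norm e\<close> to exceed \<open>1/(k+1)\<close>, the scale \<open>1/(k+1)\<close>
    to be below \<open>\<delta>\<close>, and \<open>(k+1) r\<close> to exceed \<open>1 + C r\<close> for all \<open>r \<ge> \<epsilon>\<close>.\<close>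
  obtain k0 :: nat where k0: "1 / norm e + 1 / \<delta> + 1 / \<epsilon> + C < real k0" using reals_Archimedean2 by blast
  obtain k where k: "k \<in> J3" "k0 \<le> k" using J3 unfolding infinite_nat_iff_unbounded_le by blast
  have k_large: "1 / norm e < real (Suc k)" "1 / \<delta> < real (Suc k)" "1 / \<epsilon> + C < real (Suc k)"
  proof -
    have "0 < 1 / norm e" "0 < 1 / \<delta>" "0 < 1 / \<epsilon>" using e C \<epsilon> by auto
    then show "1 / norm e < real (Suc k)" "1 / \<delta> < real (Suc k)" "1 / \<epsilon> + C < real (Suc k)"
      using k0 k(2) C(2) by linarith+
  qed
  let ?n = "\<nu> k"
  define w where "w = h (?y' ?n)"
  have "norm (\<psi> ?n (G (?y' ?n))) = norm e" unfolding G_def by (simp add: \<psi>_eq unif_cont_const)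
  moreover have "1 / real (Suc k) < norm e" using k_large(1) e by (simp add: field_simps)
  ultimately have "\<not> ereal (norm (G (?y' ?n))) \<le> ereal (real (Suc k)) * D k ?n"
    using \<nu>(2)[of k] unfolding good_def by force
  then have DG: "ereal (real (Suc k)) * D k ?n < ereal (norm (G (?y' ?n)))" by simp
  have "norm (\<psi> ?n w) = 2 / real (Suc k)"
    unfolding w_def h_def by (simp add: \<psi>_eq[OF f(1)] f(2)[OF k(1)] norm_a)
  moreover have "1 / real (Suc k) < 2 / real (Suc k)" by (simp add: divide_strict_right_mono)
  ultimately have "\<not> (norm w \<le> norm (G (?y' ?n)) \<and> ereal (norm w) \<le> ereal (real (Suc k)) * D k ?n)"
    using \<nu>(2)[of k] unfolding good_def by force
  then have Dw: "ereal (real (Suc k)) * D k ?n < ereal (norm w)"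
    using DG by (meson ereal_less_eq(3) less_imp_le not_le order_trans)
  obtain r where r: "D k ?n = ereal r"
    using Dw chain_dist_nonneg[of "1 / real (Suc k)" "?y' ?n" "?y ?n"] by (cases "D k ?n") (auto simp: D_def)
  have "ereal (dist (?y' ?n) (?y ?n)) \<le> ereal r" unfolding r[symmetric] D_def by (rule dist_le_chain_dist)
  then have "\<epsilon> \<le> r" using far[of ?n] by (simp add: dist_commute)
  have "ereal (norm w) \<le> 1 + ereal C * chain_dist \<delta> (?y' ?n) (?y ?n)"
    using C(3)[of "?y' ?n" "?y ?n"] h0[OF k(1)] by (simp add: w_def)
  also have "\<dots> \<le> 1 + ereal C * D k ?n"
    unfolding D_def using C(1,2) k_large(2)
    by (intro add_left_mono ereal_mult_left_mono chain_dist_antimono) (auto simp: field_simps)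
  finally have "norm w \<le> 1 + C * r" by (simp add: r one_ereal_def)
  moreover have "real (Suc k) * r < norm w" using Dw by (simp add: r)
  moreover have "(1 / \<epsilon> + C) * r \<le> real (Suc k) * r"
    using k_large(3) \<open>\<epsilon> \<le> r\<close> \<epsilon> by (intro mult_right_mono) auto
  moreover have "1 \<le> 1 / \<epsilon> * r" using \<open>\<epsilon> \<le> r\<close> \<epsilon> by simp
  ultimately show False by (simp add: algebra_simps)
qed

section \<open>Continuity of the fibre maps\<close>

text \<open>A sequence in \<open>Y \<times> E\<close> that converges to \<open>(y0, e0)\<close> can be perturbed so that its points in \<open>Y\<close> differ
  from the accumulation point \<open>y0\<close>. Then tents of heights tending to \<open>0\<close> yield a uniformly continuous
  function that takes the given values along a subsequence, and its image under \<open>T\<close> is continuous.\<close>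

lemma fibre_map_isCont:
  assumes "y0 \<in> accumulation_points"
  shows "isCont (\<lambda>(y, e). T (\<lambda>_. e) y) (y0, e0)"
  unfolding continuous_at_sequentially
proof (intro allI impI)
  fix q assume q: "q \<longlonglongrightarrow> (y0, e0)"
  define y e where "y n = fst (q n)" and "e n = snd (q n)" for n
  have y: "y \<longlonglongrightarrow> y0" and e: "e \<longlonglongrightarrow> e0"
    using tendsto_fst[OF q] tendsto_snd[OF q] by (simp_all add: y_def[abs_def] e_def[abs_def])
  let ?T = "\<lambda>e. T (\<lambda>_. e)"
  have T: "?T e \<in> unif_cont_maps" for e by (rule T_in[OF unif_cont_const])
  have "(\<lambda>n. dist (?T (e n) (y n)) (?T e0 y0)) \<longlonglongrightarrow> 0"
  proof (rule ccontr)
    assume "\<not> ?thesis"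
    then have "\<not> ((\<lambda>n. dist (?T (e n) (y n)) (?T e0 y0)) \<longlongrightarrow> 0) (along UNIV)" by simp
    then obtain J \<epsilon> where J: "infinite J" "0 < \<epsilon>" "\<And>n. n \<in> J \<Longrightarrow> \<epsilon> \<le> dist (?T (e n) (y n)) (?T e0 y0)"
      by (rule not_tendsto_along) auto
    have "\<exists>v. v \<noteq> y0 \<and> dist (y n) v < 1 / real (Suc n) \<and> dist (?T (e n) v) (?T (e n) (y n)) < \<epsilon>/2" for n
    proof (cases "y n = y0")
      case False
      then show ?thesis using J(2) by (intro exI[of _ "y n"]) auto
    next
      case True
      have "\<epsilon>/2 > 0" using J(2) by simp
      then obtain \<eta> where \<eta>: "0 < \<eta>" "\<And>a b. dist a b < \<eta> \<Longrightarrow> norm (?T (e n) a - ?T (e n) b) < \<epsilon>/2"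
        using unif_cont_mapsD[OF T] by blast
      have "y0 islimpt UNIV" using assms by (simp add: accumulation_points_def)
      moreover have "0 < min \<eta> (1 / real (Suc n))" using \<eta>(1) by simp
      ultimately obtain v where "v \<noteq> y0" "dist v y0 < min \<eta> (1 / real (Suc n))"
        unfolding islimpt_approachable by blast
      then show ?thesis using \<eta>(2)[of v y0] True by (intro exI[of _ v]) (simp add: dist_norm dist_commute)
    qed
    then obtain v where v: "\<And>n. v n \<noteq> y0" "\<And>n. dist (y n) (v n) < 1 / real (Suc n)"
      "\<And>n. dist (?T (e n) (v n)) (?T (e n) (y n)) < \<epsilon>/2" by metis
    have "(\<lambda>n. dist (y n) (v n)) \<longlonglongrightarrow> 0" using v(2) by (intro tendsto_0_if_less_inverse_Suc) auto
    then have v_lim: "(v \<longlongrightarrow> y0) (along K)" for K using tendsto_close[OF y] tendsto_along by blast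
    define x x0 where "x n = support_map S (v n)" and "x0 = support_map S y0" for n
    have \<phi>x: "\<phi> (x n) = v n" "\<phi> x0 = y0" for n by (simp_all add: x_def x0_def support_map_inverse')
    have x: "(x \<longlongrightarrow> x0) (along J)"
      using biseparating_pair.support_map_tendsto[OF dual v_lim] by (simp add: x_def[abs_def] x0_def)
    have ne: "x n \<noteq> x0" for n using \<phi>x v(1) by metis
    obtain K where K: "K \<subseteq> J" "infinite K"
      "\<And>m n. m \<in> K \<Longrightarrow> n \<in> K \<Longrightarrow> m < n \<Longrightarrow> dist (x m) x0 / 2 + dist (x n) x0 / 2 \<le> dist (x m) (x n)"
      by (rule sparse_subset[OF J(1) x ne]) (rule that)
    have "((\<lambda>n. norm (e n - e0)) \<longlongrightarrow> 0) (along K)"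
      using e by (intro tendsto_along) (simp add: tendsto_norm_zero_iff LIM_zero_iff)
    then have adm: "admissible_heights (\<lambda>n. norm (e n - e0)) (\<lambda>n. dist (x n) x0 / 2) K"
      by (rule admissible_heights_null) (use ne in simp)
    obtain f where f: "f \<in> unif_cont_maps" "\<And>n. n \<in> K \<Longrightarrow> f (x n) = e n - e0"
      "\<And>z. (\<And>n. n \<in> K \<Longrightarrow> dist (x n) x0 / 2 \<le> dist (x n) z) \<Longrightarrow> f z = 0"
    proof (rule tents_dist[of K "\<lambda>n. dist (x n) x0 / 2" x, OF _ _ adm])
      show "0 < dist (x n) x0 / 2" for n using ne by simp
    qed (rule K(3), assumption+, rule that, assumption, simp, simp)
    define k where "k z = e0 + f z" for z
    have k: "k \<in> unif_cont_maps" using unif_cont_add[OF unif_cont_const f(1)] by (simp add: k_def[abs_def])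
    have "f x0 = 0" by (rule f(3)) simp
    then have Tk0: "T k y0 = ?T e0 y0"
      using agree_at[OF k unif_cont_const, of x0 e0] by (simp add: \<phi>x k_def)
    have Tk: "T k (v n) = ?T (e n) (v n)" if "n \<in> K" for n
      using agree_at[OF k unif_cont_const, of "x n" "e n"] f(2)[OF that] by (simp add: \<phi>x k_def)
    have "((\<lambda>n. T k (v n)) \<longlongrightarrow> T k y0) (along K)"
      by (rule isCont_tendsto_compose[OF unif_cont_isCont[OF T_in[OF k]] v_lim])
    then have "\<forall>\<^sub>F n in along K. dist (T k (v n)) (T k y0) < \<epsilon>/2" by (rule tendstoD) (use J(2) in simp)
    from eventually_along_ex[OF this K(2)] obtain n where n: "n \<in> K" "dist (T k (v n)) (T k y0) < \<epsilon>/2" by blast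
    have "dist (?T (e n) (v n)) (?T e0 y0) < \<epsilon>/2" using n(2) Tk[OF n(1)] Tk0 by simp
    moreover have "\<epsilon> \<le> dist (?T (e n) (y n)) (?T e0 y0)" using J(3) n(1) K(1) by blast
    ultimately show False
      using v(3)[of n] dist_triangle[of "?T (e n) (y n)" "?T e0 y0" "?T (e n) (v n)"] by (simp add: dist_commute)
  qed
  then have "(\<lambda>n. ?T (e n) (y n)) \<longlonglongrightarrow> ?T e0 y0" using tendsto_dist_iff by blast
  then show "((\<lambda>(y, e). T (\<lambda>_. e) y) \<circ> q) \<longlonglongrightarrow> (case (y0, e0) of (y, e) \<Rightarrow> T (\<lambda>_. e) y)"
    by (simp add: y_def e_def o_def case_prod_beta)
qed

text \<open>Along a subsequence, the \<open>u\<close>-sequence is part of the graph of a sum of tents by \<open>chain_ball_radii\<close>. A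
  further sum of tents of heights tending to \<open>0\<close> adjusts the values at the \<open>z' n\<close>, and then \<open>T\<close> is applied
  to the resulting function.\<close>

lemma fibre_map_u_continuous: "u_continuous (\<lambda>(x, e). T (\<lambda>_. e) (\<phi> x))"
  unfolding u_continuous_def
proof (intro allI impI)
  fix z z' :: "nat \<Rightarrow> 'x" and e e' :: "nat \<Rightarrow> 'e"
  assume u: "u_sequence z e" and ne: "\<forall>n. z n \<noteq> z' n"
    and lim: "(\<lambda>n. dist (z n) (z' n) + norm (e n - e' n)) \<longlonglongrightarrow> 0"
  have d: "(\<lambda>n. dist (z n) (z' n)) \<longlonglongrightarrow> 0" and ee: "(\<lambda>n. norm (e n - e' n)) \<longlonglongrightarrow> 0"
    by (rule real_tendsto_sandwich[OF _ _ tendsto_const lim]; simp)+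
  let ?T = "\<lambda>e. T (\<lambda>_. e)"
  obtain s where s: "0 < s" "separated_on s z UNIV"
    using u by (auto simp: u_sequence_def separated_seq_iff)
  obtain \<delta> C where C: "0 < \<delta>" "0 \<le> C" "\<And>m n. ereal (norm (e n - e m)) \<le> ereal C * chain_dist \<delta> (z n) (z m)"
    using u unfolding u_sequence_def by blast
  have "(\<lambda>n. norm (?T (e n) (\<phi> (z n)) - ?T (e' n) (\<phi> (z' n)))) \<longlonglongrightarrow> 0"
  proof (rule ccontr)
    assume "\<not> ?thesis"
    then have "\<not> ((\<lambda>n. norm (?T (e n) (\<phi> (z n)) - ?T (e' n) (\<phi> (z' n)))) \<longlongrightarrow> 0) (along UNIV)" by simp
    then obtain J \<epsilon> where J: "infinite J" "0 < \<epsilon>"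
      "\<And>n. n \<in> J \<Longrightarrow> \<epsilon> \<le> norm (?T (e n) (\<phi> (z n)) - ?T (e' n) (\<phi> (z' n)))"
      by (rule not_tendsto_along) auto
    have sJ: "separated_on s z J" using s(2) by (rule separated_on_subset) simp
    obtain J1 \<rho> K where J1: "J1 \<subseteq> J" "infinite J1" "disjoint_chain_balls \<delta> z \<rho> J1"
      "\<And>n. n \<in> J1 \<Longrightarrow> norm (e n) + 1 \<le> K * \<rho> n"
      by (rule chain_ball_radii[OF J(1) s(1) sJ C(2,3)]) (rule that)
    have adm: "admissible_heights (\<lambda>n. norm (e n)) \<rho> J1"
    proof (rule admissible_heights_linear)
      show "norm (e n) \<le> K * \<rho> n" if "n \<in> J1" for n using J1(4)[OF that] by simp
      show "0 < \<rho> n" if "n \<in> J1" for n using J1(3) that by (auto simp: disjoint_chain_balls_def)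
    qed
    obtain g where g: "g \<in> unif_cont_maps" "\<And>n. n \<in> J1 \<Longrightarrow> g (z n) = e n"
      using tents[OF C(1) J1(3) adm] by metis
    define w where "w n = e' n - g (z' n)" for n
    have "((\<lambda>n. norm (e n - e' n) + norm (g (z n) - g (z' n))) \<longlongrightarrow> 0 + 0) (along J1)"
      by (intro tendsto_add tendsto_along ee unif_cont_along[OF g(1)] d)
    then have lim1: "((\<lambda>n. norm (e n - e' n) + norm (g (z n) - g (z' n))) \<longlongrightarrow> 0) (along J1)" by simp
    have w: "((\<lambda>n. norm (w n)) \<longlongrightarrow> 0) (along J1)"
    proof (rule Lim_null_comparison[OF _ lim1])
      have "norm (w n) \<le> norm (e n - e' n) + norm (g (z n) - g (z' n))" if "n \<in> J1" for n
        using norm_triangle_ineq4[of "g (z n) - g (z' n)" "e n - e' n"] g(2)[OF that]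
        by (simp add: w_def add.commute)
      then show "\<forall>\<^sub>F n in along J1. norm (norm (w n)) \<le> norm (e n - e' n) + norm (g (z n) - g (z' n))"
        by (auto simp: eventually_along)
    qed
    have sJ1: "separated_on s z J1" using s(2) by (rule separated_on_subset) simp
    obtain J2 f where J2: "J2 \<subseteq> J1" "infinite J2" and f: "f \<in> unif_cont_maps"
      "\<And>n. n \<in> J2 \<Longrightarrow> f (z' n) = w n" "\<And>n. n \<in> J2 \<Longrightarrow> f (z n) = 0"
      by (rule perturb_near_separated[OF J1(2) s(1) sJ1 tendsto_along[OF d] _ w]) (use ne that in blast)+
    define k where "k x = g x + f x" for x
    have k: "k \<in> unif_cont_maps" using unif_cont_add[OF g(1) f(1)] by (simp add: k_def[abs_def])
    have Tk: "T k (\<phi> (z n)) = ?T (e n) (\<phi> (z n))" "T k (\<phi> (z' n)) = ?T (e' n) (\<phi> (z' n))" if "n \<in> J2" for n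
      using agree_at[OF k unif_cont_const, of "z n" "e n"] agree_at[OF k unif_cont_const, of "z' n" "e' n"]
        f(2,3)[OF that] g(2)[of n] that J2(1) by (auto simp: k_def w_def)
    have Tk\<phi>: "(\<lambda>x. T k (\<phi> x)) \<in> unif_cont_maps"
      by (rule unif_cont_compose[OF T_in[OF k] support_map_unif_cont])
    have "((\<lambda>n. norm (T k (\<phi> (z n)) - T k (\<phi> (z' n)))) \<longlongrightarrow> 0) (along J2)"
      by (rule unif_cont_along[OF Tk\<phi> tendsto_along[OF d]])
    then have "\<forall>\<^sub>F n in along J2. norm (T k (\<phi> (z n)) - T k (\<phi> (z' n))) < \<epsilon>" using J(2) by (rule order_tendstoD(2))
    from eventually_along_ex[OF this J2(2)] obtain n where n: "n \<in> J2"
      "norm (T k (\<phi> (z n)) - T k (\<phi> (z' n))) < \<epsilon>" by blast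
    then show False using Tk[OF n(1)] J(3)[of n] J2(1) J1(1) by auto
  qed
  then show "(\<lambda>n. norm ((case (z n, e n) of (x, e) \<Rightarrow> ?T e (\<phi> x)) - (case (z' n, e' n) of (x, e) \<Rightarrow> ?T e (\<phi> x)))) \<longlonglongrightarrow> 0"
    by simp
qed

end

section \<open>Fibrewise maps of uniformly continuous functions\<close>

text \<open>Two sequences that violate uniform continuity and converge have different terms, so that their limit
  is an accumulation point. If they have no convergent subsequence, they are separated along a
  subsequence, and \<open>u\<close>-continuity applies.\<close>

lemma unif_cont_fibrewise:
  fixes \<Xi> :: "'x::complete_space \<times> 'e::real_normed_vector \<Rightarrow> 'f::real_normed_vector"
  assumes cont: "\<And>x e. x \<in> accumulation_points \<Longrightarrow> isCont \<Xi> (x, e)" and u: "u_continuous \<Xi>"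
    and f: "f \<in> unif_cont_maps"
  shows "(\<lambda>x. \<Xi> (x, f x)) \<in> unif_cont_maps"
proof (rule ccontr)
  assume "\<not> ?thesis"
  then obtain \<epsilon> where \<epsilon>: "0 < \<epsilon>"
    and bad: "\<And>d. 0 < d \<Longrightarrow> \<exists>a b. dist a b < d \<and> \<epsilon> \<le> norm (\<Xi> (a, f a) - \<Xi> (b, f b))"
    using unif_cont_mapsI[of "\<lambda>x. \<Xi> (x, f x)"] by (metis not_less)
  have "\<exists>a b. dist a b < 1 / real (Suc n) \<and> \<epsilon> \<le> norm (\<Xi> (a, f a) - \<Xi> (b, f b))" for n by (rule bad) simp
  then obtain x x' where close: "\<And>n. dist (x n) (x' n) < 1 / real (Suc n)"
    and far: "\<And>n. \<epsilon> \<le> norm (\<Xi> (x n, f (x n)) - \<Xi> (x' n, f (x' n)))" by metis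
  have ne: "x n \<noteq> x' n" for n using far[of n] \<epsilon> by auto
  have d: "(\<lambda>n. dist (x n) (x' n)) \<longlonglongrightarrow> 0" using close by (intro tendsto_0_if_less_inverse_Suc) auto
  show False
    using infinite_UNIV_nat
  proof (cases rule: convergent_or_separated[where z = x])
    case (convergent J l)
    have x': "(x' \<longlongrightarrow> l) (along J)" by (rule tendsto_close[OF convergent(3) tendsto_along[OF d]])
    have "l islimpt UNIV"
      unfolding islimpt_approachable
    proof (intro allI impI)
      fix r :: real assume "0 < r"
      have "\<forall>\<^sub>F n in along J. dist (x n) l < r \<and> dist (x' n) l < r"
        by (intro eventually_conj tendstoD[OF convergent(3)] tendstoD[OF x'] \<open>0 < r\<close>)
      from eventually_along_ex[OF this convergent(2)] obtain n where "dist (x n) l < r" "dist (x' n) l < r" by blast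
      then show "\<exists>v\<in>UNIV. v \<noteq> l \<and> dist v l < r" using ne[of n] by (metis UNIV_I)
    qed
    then have iso: "isCont \<Xi> (l, f l)" by (intro cont) (simp add: accumulation_points_def)
    have lim: "((\<lambda>n. \<Xi> (u n, f (u n))) \<longlongrightarrow> \<Xi> (l, f l)) (along J)" if "(u \<longlongrightarrow> l) (along J)" for u
      by (intro isCont_tendsto_compose[OF iso] tendsto_Pair that isCont_tendsto_compose[OF unif_cont_isCont[OF f] that])
    have "((\<lambda>n. norm (\<Xi> (x n, f (x n)) - \<Xi> (x' n, f (x' n)))) \<longlongrightarrow> norm (\<Xi> (l, f l) - \<Xi> (l, f l))) (along J)"
      by (intro tendsto_norm tendsto_diff lim convergent(3) x')
    then have "\<forall>\<^sub>F n in along J. norm (\<Xi> (x n, f (x n)) - \<Xi> (x' n, f (x' n))) < \<epsilon>"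
      by (rule order_tendstoD(2)) (use \<epsilon> in simp)
    from eventually_along_ex[OF this convergent(2)] show False using far by (metis not_less)
  next
    case (separated J s)
    let ?q = "enumerate J"
    have q: "strict_mono ?q" using separated(2) by (simp add: strict_mono_enumerate)
    have sep: "separated_on s (\<lambda>n. x (?q n)) UNIV"
      using separated(4) enumerate_in_set[OF separated(2)] strict_mono_eq[OF q]
      unfolding separated_on_def by blast
    obtain \<delta> C where C: "0 < \<delta>" "0 < C"
      "\<And>a b. a = b \<or> s \<le> dist a b \<Longrightarrow> ereal (norm (f a - f b)) \<le> ereal C * chain_dist \<delta> a b"
      using unif_cont_u_sequence[OF f separated(3)] by blast
    have "u_sequence (\<lambda>n. x (?q n)) (\<lambda>n. f (x (?q n)))"
      unfolding u_sequence_def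
    proof (rule conjI, goal_cases)
      case 1
      show ?case using sep separated(3) by (auto simp: separated_seq_iff)
    next
      case 2
      have "ereal (norm (f (x (?q n)) - f (x (?q m)))) \<le> ereal C * chain_dist \<delta> (x (?q n)) (x (?q m))" for m n
        using sep by (intro C(3)) (cases "n = m", auto simp: separated_on_def)
      then show ?case using C(1,2) less_imp_le by blast
    qed
    moreover have "(\<lambda>n. dist (x n) (x' n) + norm (f (x n) - f (x' n))) \<longlonglongrightarrow> 0 + 0"
      by (intro tendsto_add d unif_cont_along[OF f d])
    then have "(\<lambda>n. dist (x (?q n)) (x' (?q n)) + norm (f (x (?q n)) - f (x' (?q n)))) \<longlonglongrightarrow> 0"
      using LIMSEQ_subseq_LIMSEQ[OF _ q] by (fastforce simp: o_def)
    ultimately have "(\<lambda>n. norm (\<Xi> (x (?q n), f (x (?q n))) - \<Xi> (x' (?q n), f (x' (?q n))))) \<longlonglongrightarrow> 0"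
      using u[unfolded u_continuous_def, rule_format,
          of "\<lambda>n. x (?q n)" "\<lambda>n. f (x (?q n))" "\<lambda>n. x' (?q n)" "\<lambda>n. f (x' (?q n))"] ne by blast
    then have "\<forall>\<^sub>F n in sequentially. norm (\<Xi> (x (?q n), f (x (?q n))) - \<Xi> (x' (?q n), f (x' (?q n)))) < \<epsilon>"
      using \<epsilon> by (rule order_tendstoD(2))
    then obtain n where "norm (\<Xi> (x (?q n), f (x (?q n))) - \<Xi> (x' (?q n), f (x' (?q n)))) < \<epsilon>"
      using eventually_happens by fastforce
    then show False using far[of "?q n"] by simp
  qed
qed

lemma accumulation_point_image:
  fixes \<theta> :: "'a::metric_space \<Rightarrow> 'b::metric_space"
  assumes "inj \<theta>" "uniformly_continuous_on UNIV \<theta>" "x \<in> accumulation_points"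
  shows "\<theta> x \<in> accumulation_points"
proof -
  have "isCont \<theta> x"
    using assms(2) uniformly_continuous_imp_continuous continuous_on_eq_continuous_at open_UNIV by blast
  have "\<exists>v\<in>UNIV. v \<noteq> \<theta> x \<and> dist v (\<theta> x) < r" if "0 < r" for r
  proof -
    obtain \<delta> where \<delta>: "0 < \<delta>" "\<And>z. dist z x < \<delta> \<Longrightarrow> dist (\<theta> z) (\<theta> x) < r"
      using \<open>isCont \<theta> x\<close> \<open>0 < r\<close> unfolding continuous_at_eps_delta by blast
    obtain z where "z \<noteq> x" "dist z x < \<delta>"
      using assms(3) \<delta>(1) unfolding accumulation_points_def islimpt_approachable by blast
    then show ?thesis using \<delta>(2) assms(1) by (metis UNIV_I injD)
  qed
  then show ?thesis by (simp add: accumulation_points_def islimpt_approachable)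
qed

lemma unif_cont_transported:
  fixes \<theta> :: "'x::complete_space \<Rightarrow> 'y::complete_space" and \<Theta> :: "'y \<times> 'e::real_normed_vector \<Rightarrow> 'f::real_normed_vector"
  assumes \<theta>: "uniform_homeomorphism \<theta>" and cont: "\<forall>p\<in>accumulation_points \<times> UNIV. isCont \<Theta> p"
    and u: "u_continuous (\<lambda>(x, e). \<Theta> (\<theta> x, e))" and f: "f \<in> unif_cont_maps"
  shows "(\<lambda>y. \<Theta> (y, f (inv \<theta> y))) \<in> unif_cont_maps"
proof -
  have bij: "bij \<theta>" and uc: "uniformly_continuous_on UNIV \<theta>" "uniformly_continuous_on UNIV (inv \<theta>)"
    using \<theta> by (auto simp: uniform_homeomorphism_def)
  let ?\<Xi> = "\<lambda>(x, e). \<Theta> (\<theta> x, e)"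
  have "isCont ?\<Xi> (x, e)" if "x \<in> accumulation_points" for x e
  proof -
    have "isCont \<theta> x"
      using uc(1) uniformly_continuous_imp_continuous continuous_on_eq_continuous_at open_UNIV by blast
    then have "isCont (\<lambda>p. \<theta> (fst p)) (x, e)"
      by (intro isCont_o2[where f = fst and g = \<theta>] isCont_fst continuous_ident) simp
    then have "isCont (\<lambda>p. (\<theta> (fst p), snd p)) (x, e)"
      by (intro continuous_Pair isCont_snd continuous_ident)
    moreover have "isCont \<Theta> (\<theta> x, e)"
      using cont accumulation_point_image[OF bij_is_inj[OF bij] uc(1) that] by blast
    ultimately show ?thesis
      using isCont_o2[of "(x, e)" "\<lambda>p. (\<theta> (fst p), snd p)" \<Theta>] by (simp add: case_prod_beta')
  qed
  from unif_cont_fibrewise[OF this u f] have "(\<lambda>x. \<Theta> (\<theta> x, f x)) \<in> unif_cont_maps" by simp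
  then have "(\<lambda>y. \<Theta> (\<theta> (inv \<theta> y), f (inv \<theta> y))) \<in> unif_cont_maps"
    by (rule unif_cont_compose[OF _ uc(2)])
  then show ?thesis using bij by (simp add: bij_is_surj surj_f_inv_f)
qed

lemma biseparating_pair_inv_into:
  fixes T :: "('x::complete_space \<Rightarrow> 'e::banach) \<Rightarrow> ('y::complete_space \<Rightarrow> 'f::banach)"
  assumes T: "biseparating unif_cont_maps unif_cont_maps T"
    and "\<exists>e::'e. e \<noteq> 0" "\<exists>e::'f. e \<noteq> 0"
  shows "biseparating_pair T (inv_into unif_cont_maps T)"
proof (rule biseparating_pair.intro)
  have bij: "bij_betw T unif_cont_maps unif_cont_maps" using T by (simp add: biseparating_def)
  show "T f \<in> unif_cont_maps" if "f \<in> unif_cont_maps" for f using bij_betwE[OF bij] that by blast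
  show "inv_into unif_cont_maps T g \<in> unif_cont_maps" if "g \<in> unif_cont_maps" for g
    using bij_betwE[OF bij_betw_inv_into[OF bij]] that by blast
  show "inv_into unif_cont_maps T (T f) = f" if "f \<in> unif_cont_maps" for f
    using bij_betw_inv_into_left[OF bij that] .
  show "T (inv_into unif_cont_maps T g) = g" if "g \<in> unif_cont_maps" for g
    using bij_betw_inv_into_right[OF bij that] .
  have perp: "perp_rel h f g \<longleftrightarrow> (\<forall>x. f x = h x \<or> g x = h x)" for h f g :: "'z \<Rightarrow> 'w::group_add"
    by (auto simp: perp_rel_def cozero_def)
  show "(\<forall>x. f x = h x \<or> g x = h x) = (\<forall>y. T f y = T h y \<or> T g y = T h y)"
    if "f \<in> unif_cont_maps" "g \<in> unif_cont_maps" "h \<in> unif_cont_maps" for f g h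
    using T that unfolding biseparating_def perp by blast
qed (use assms in auto)

theorem theorem7p7:
  assumes "\<exists>e::'e::banach. e \<noteq> 0"
    and "\<exists>e'::'f::banach. e' \<noteq> 0"
  shows
   "(\<forall>T :: ('x::complete_space \<Rightarrow> 'e) \<Rightarrow> ('y::complete_space \<Rightarrow> 'f).
       biseparating unif_cont_maps unif_cont_maps T \<longrightarrow>
       (\<exists>(\<phi> :: 'x \<Rightarrow> 'y) (\<Phi> :: 'y \<times> 'e \<Rightarrow> 'f) (\<Psi> :: 'x \<times> 'f \<Rightarrow> 'e).
          uniform_homeomorphism \<phi> \<and>
          fibrewise_inverse \<phi> \<Phi> \<Psi> \<and>
          (\<forall>f\<in>unif_cont_maps. \<forall>y. T f y = \<Phi> (y, f (inv \<phi> y))) \<and>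
          (\<forall>g\<in>unif_cont_maps. \<forall>x. inv_into unif_cont_maps T g x = \<Psi> (x, g (\<phi> x))) \<and>
          (\<forall>p\<in>accumulation_points \<times> UNIV. isCont \<Phi> p) \<and>
          (\<forall>p\<in>accumulation_points \<times> UNIV. isCont \<Psi> p) \<and>
          u_continuous (\<lambda>(x, e). \<Phi> (\<phi> x, e)) \<and>
          u_continuous (\<lambda>(y, e'). \<Psi> (inv \<phi> y, e')))) \<and>
    (\<forall>(\<phi> :: 'x \<Rightarrow> 'y) (\<Phi> :: 'y \<times> 'e \<Rightarrow> 'f) (\<Psi> :: 'x \<times> 'f \<Rightarrow> 'e).
       uniform_homeomorphism \<phi> \<longrightarrow>
       fibrewise_inverse \<phi> \<Phi> \<Psi> \<longrightarrow>
       (\<forall>p\<in>accumulation_points \<times> UNIV. isCont \<Phi> p) \<longrightarrow>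
       (\<forall>p\<in>accumulation_points \<times> UNIV. isCont \<Psi> p) \<longrightarrow>
       u_continuous (\<lambda>(x, e). \<Phi> (\<phi> x, e)) \<longrightarrow>
       u_continuous (\<lambda>(y, e'). \<Psi> (inv \<phi> y, e')) \<longrightarrow>
       biseparating (unif_cont_maps :: ('x \<Rightarrow> 'e) set) (unif_cont_maps :: ('y \<Rightarrow> 'f) set)
         (\<lambda>f y. \<Phi> (y, f (inv \<phi> y))))"
proof (intro conjI allI impI)
  fix T :: "('x \<Rightarrow> 'e) \<Rightarrow> ('y \<Rightarrow> 'f)"
  assume T: "biseparating unif_cont_maps unif_cont_maps T"
  define S where "S = inv_into unif_cont_maps T"
  interpret biseparating_pair T S
    unfolding S_def using T assms by (rule biseparating_pair_inv_into)
  interpret dual: biseparating_pair S T by (rule dual)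
  have bij: "bij \<phi>"
    by (rule o_bij[of "support_map S"]) (auto simp: support_map_inverse support_map_inverse')
  have inv_\<phi>: "inv \<phi> = support_map S"
    by (rule inv_unique_comp) (auto simp: support_map_inverse support_map_inverse')
  define \<Phi> where "\<Phi> = (\<lambda>(y, e). T (\<lambda>_. e) y)"
  define \<Psi> where "\<Psi> = (\<lambda>(x, e'). S (\<lambda>_. e') x)"
  have \<Phi>: "\<Phi> (y, f (support_map S y)) = T f y" if "f \<in> unif_cont_maps" for f y
    using agree_at[OF that unif_cont_const, of "support_map S y"] by (simp add: \<Phi>_def support_map_inverse')
  have \<Psi>: "\<Psi> (x, g (\<phi> x)) = S g x" if "g \<in> unif_cont_maps" for g x
    using agree_at_S[OF that unif_cont_const, of x] by (simp add: \<Psi>_def)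
  have left: "\<Psi> (x, \<Phi> (\<phi> x, e)) = e" for x e
    using \<Psi>[OF T_in[OF unif_cont_const], of x e] by (simp add: \<Phi>_def ST unif_cont_const)
  have right: "\<Phi> (\<phi> x, \<Psi> (x, e')) = e'" for x e'
    using \<Phi>[OF S_in[OF unif_cont_const], of "\<phi> x" e']
    by (simp add: \<Psi>_def TS unif_cont_const support_map_inverse)
  show "\<exists>(\<phi> :: 'x \<Rightarrow> 'y) (\<Phi> :: 'y \<times> 'e \<Rightarrow> 'f) (\<Psi> :: 'x \<times> 'f \<Rightarrow> 'e).
          uniform_homeomorphism \<phi> \<and>
          fibrewise_inverse \<phi> \<Phi> \<Psi> \<and>
          (\<forall>f\<in>unif_cont_maps. \<forall>y. T f y = \<Phi> (y, f (inv \<phi> y))) \<and>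
          (\<forall>g\<in>unif_cont_maps. \<forall>x. inv_into unif_cont_maps T g x = \<Psi> (x, g (\<phi> x))) \<and>
          (\<forall>p\<in>accumulation_points \<times> UNIV. isCont \<Phi> p) \<and>
          (\<forall>p\<in>accumulation_points \<times> UNIV. isCont \<Psi> p) \<and>
          u_continuous (\<lambda>(x, e). \<Phi> (\<phi> x, e)) \<and>
          u_continuous (\<lambda>(y, e'). \<Psi> (inv \<phi> y, e'))"
  proof (intro exI[of _ \<phi>] exI[of _ \<Phi>] exI[of _ \<Psi>] conjI ballI allI)
    show "uniform_homeomorphism \<phi>"
      using bij support_map_unif_cont dual.support_map_unif_cont
      by (simp add: uniform_homeomorphism_def inv_\<phi>)
    show "fibrewise_inverse \<phi> \<Phi> \<Psi>"
      unfolding fibrewise_inverse_def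
    proof (intro allI impI conjI)
      fix x y assume "\<phi> x = y"
      then show "bij (\<lambda>e. \<Phi> (y, e))" "inv (\<lambda>e. \<Phi> (y, e)) = (\<lambda>e'. \<Psi> (x, e'))"
        using left[of x] right[of x]
        by (auto intro!: o_bij[of "\<lambda>e'. \<Psi> (x, e')"] inv_unique_comp)
    qed
    show "T f y = \<Phi> (y, f (inv \<phi> y))" if "f \<in> unif_cont_maps" for f y using \<Phi>[OF that] by (simp add: inv_\<phi>)
    show "inv_into unif_cont_maps T g x = \<Psi> (x, g (\<phi> x))" if "g \<in> unif_cont_maps" for g x
      using \<Psi>[OF that] by (simp add: S_def)
    show "isCont \<Phi> p" if "p \<in> accumulation_points \<times> UNIV" for p
      using that fibre_map_isCont by (auto simp: \<Phi>_def)
    show "isCont \<Psi> p" if "p \<in> accumulation_points \<times> UNIV" for p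
      using that dual.fibre_map_isCont by (auto simp: \<Psi>_def)
    show "u_continuous (\<lambda>(x, e). \<Phi> (\<phi> x, e))"
      using fibre_map_u_continuous by (simp add: \<Phi>_def)
    show "u_continuous (\<lambda>(y, e'). \<Psi> (inv \<phi> y, e'))"
      using dual.fibre_map_u_continuous by (simp add: \<Psi>_def inv_\<phi>)
  qed
next
  fix \<phi> :: "'x \<Rightarrow> 'y" and \<Phi> :: "'y \<times> 'e \<Rightarrow> 'f" and \<Psi> :: "'x \<times> 'f \<Rightarrow> 'e"
  assume \<phi>: "uniform_homeomorphism \<phi>" and fib: "fibrewise_inverse \<phi> \<Phi> \<Psi>"
    and cont: "\<forall>p\<in>accumulation_points \<times> UNIV. isCont \<Phi> p" "\<forall>p\<in>accumulation_points \<times> UNIV. isCont \<Psi> p"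
    and u: "u_continuous (\<lambda>(x, e). \<Phi> (\<phi> x, e))" "u_continuous (\<lambda>(y, e'). \<Psi> (inv \<phi> y, e'))"
  have bij: "bij \<phi>" using \<phi> by (simp add: uniform_homeomorphism_def)
  have inv: "inv \<phi> (\<phi> x) = x" "\<phi> (inv \<phi> y) = y" for x y
    using bij by (auto simp: bij_is_inj bij_is_surj surj_f_inv_f)
  have \<phi>': "uniform_homeomorphism (inv \<phi>)"
    using \<phi> by (simp add: uniform_homeomorphism_def bij_imp_bij_inv inv_inv_eq)
  have bij_\<Phi>: "bij (\<lambda>e. \<Phi> (\<phi> x, e))" and \<Psi>: "inv (\<lambda>e. \<Phi> (\<phi> x, e)) = (\<lambda>e'. \<Psi> (x, e'))" for x
    using fib by (auto simp: fibrewise_inverse_def)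
  have left: "\<Psi> (x, \<Phi> (\<phi> x, e)) = e" for x e
    using inv_f_f[OF bij_is_inj[OF bij_\<Phi>[of x]], of e] unfolding \<Psi> .
  have right: "\<Phi> (\<phi> x, \<Psi> (x, e')) = e'" for x e'
    using surj_f_inv_f[OF bij_is_surj[OF bij_\<Phi>[of x]], of e'] unfolding \<Psi> .
  let ?T = "\<lambda>f y. \<Phi> (y, f (inv \<phi> y))" and ?S = "\<lambda>g x. \<Psi> (x, g (\<phi> x))"
  have T_in: "?T f \<in> unif_cont_maps" if "f \<in> unif_cont_maps" for f
    by (rule unif_cont_transported[OF \<phi> cont(1) u(1) that])
  have S_in: "?S g \<in> unif_cont_maps" if "g \<in> unif_cont_maps" for g
    using unif_cont_transported[OF \<phi>' cont(2) u(2) that] by (simp add: inv_inv_eq[OF bij])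
  have "?S (?T f) = f" for f by (simp add: inv left)
  moreover have "?T (?S g) = g" for g
    using right[of "inv \<phi> _"] by (simp add: inv)
  ultimately have "bij_betw ?T unif_cont_maps unif_cont_maps"
    by (intro bij_betw_byWitness[where f' = ?S]) (use T_in S_in in auto)
  moreover have "perp_rel h f g \<longleftrightarrow> perp_rel (?T h) (?T f) (?T g)" for f g h :: "'x \<Rightarrow> 'e"
  proof -
    have eq: "?T p (\<phi> x) = ?T q (\<phi> x) \<longleftrightarrow> p x = q x" for p q :: "'x \<Rightarrow> 'e" and x
      using left by (metis inv(1))
    have "perp_rel (?T h) (?T f) (?T g) \<longleftrightarrow> (\<forall>y. ?T f y = ?T h y \<or> ?T g y = ?T h y)"
      by (auto simp: perp_rel_def cozero_def)
    also have "\<dots> \<longleftrightarrow> (\<forall>x. ?T f (\<phi> x) = ?T h (\<phi> x) \<or> ?T g (\<phi> x) = ?T h (\<phi> x))"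
      by (metis inv(2))
    also have "\<dots> \<longleftrightarrow> perp_rel h f g" unfolding eq by (auto simp: perp_rel_def cozero_def)
    finally show ?thesis by simp
  qed
  ultimately show "biseparating (unif_cont_maps :: ('x \<Rightarrow> 'e) set) (unif_cont_maps :: ('y \<Rightarrow> 'f) set) ?T"
    unfolding biseparating_def by blast
qed

end
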